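(* Let $p$ be a prime and $s_1,s_2$ nonnegative integers. Let $f,g\in\mathbb{Z}[x]$ be monic with nonzero resultant $r$, such that $v_p(f(n))\ge s_1$ and $v_p(g(n))\ge s_2$ for all $n\in\mathbb{Z}$, and let $S=\max_{n\in\mathbb{Z}}\min\{v_p(f(n)),v_p(g(n))\}$. Then $$v_p(r)\ \ge\ S-\max\{s_1,s_2\}+p\sum_{i=0}^{\infty}p^i\,\widehat\gamma_i(s_1)\,\widehat\gamma_i(s_2).$$
   Context: For a nonnegative integer $\omega$, an integral resolution of $\omega$ is a sequence $(\gamma_i)_{i\ge0}$ of nonnegative integers with $\gamma_i\ge p\gamma_{i+1}$ for all $i$ and $\sum_{i\ge0}\gamma_i=\omega$. The minimal integral resolution $(\widehat\gamma_i(\omega))_{i\ge0}$ is the lexicographically smallest integral resolution of $\omega$ (sequences compared at the first index where they differ). The resultant of monic $f=\prod_i(x-\alpha_i)$, $g=\prod_j(x-\beta_j)$ is $r=\prod_{i,j}(\alpha_i-\beta_j)$. *)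

theory Defs
  imports "Subresultants.Resultant_Prelim" "HOL-Library.Extended_Nat"
    "HOL-Computational_Algebra.Computational_Algebra"
begin

definition vp :: "nat \<Rightarrow> int \<Rightarrow> enat" where
  "vp p x = (if x = 0 then \<infinity> else enat (multiplicity (int p) x))"

definition integral_resolution :: "nat \<Rightarrow> nat \<Rightarrow> (nat \<Rightarrow> nat) \<Rightarrow> bool" where
  "integral_resolution p \<omega> \<gamma> \<longleftrightarrow>
     (\<forall>i. p * \<gamma> (Suc i) \<le> \<gamma> i) \<and> finite {i. \<gamma> i \<noteq> 0} \<and>
     (\<Sum>i\<in>{i. \<gamma> i \<noteq> 0}. \<gamma> i) = \<omega>"

definition lex_less :: "(nat \<Rightarrow> nat) \<Rightarrow> (nat \<Rightarrow> nat) \<Rightarrow> bool" where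
  "lex_less \<gamma> \<delta> \<longleftrightarrow> (\<exists>k. (\<forall>i<k. \<gamma> i = \<delta> i) \<and> \<gamma> k < \<delta> k)"

definition min_resolution :: "nat \<Rightarrow> nat \<Rightarrow> nat \<Rightarrow> nat" where
  "min_resolution p \<omega> = (THE \<gamma>. integral_resolution p \<omega> \<gamma> \<and>
      (\<forall>\<delta>. integral_resolution p \<omega> \<delta> \<and> \<delta> \<noteq> \<gamma> \<longrightarrow> lex_less \<gamma> \<delta>))"

end

(* Extend the p-adic valuation v to a subring of the complex numbers containing all algebraic
   integers.  For the roots a_i of f put phi_k(c) = sum_i (min(v(c - a_i), k) - min(v(c - a_i), k - 1)),
   a function on the residue classes c mod p^k, and define psi_k likewise from g.  By Gauss' lemma
   these are nonnegative integers; the weights of the p children of a class sum to at most the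
   weight of the class, and the weights along the path of n add up to v(f(n)).  Since r is the product
   of all differences of roots, min(x, y) >= x * y on [0, 1] and the ultrametric inequality give
   v(r) >= sum_k sum_c phi_k(c) psi_k(c).  An induction over subtrees bounds this sum from below:
   every class has weight at least the first term of the minimal resolution of what its paths
   still need, and deviating from these terms does not pay. *)
theory Submission
  imports Defs "HOL-Number_Theory.Cong" "Subresultants.Subresultant"
begin

section \<open>Minimal resolutions and weights on the tree of residue classes\<close>

text \<open>The factor \<open>p\<close> before the sum counts the classes modulo \<open>p\<close>.
  Level 0 of the tree is left out, because every root has weight 1 there whatever its valuation, so
  the minimal resolutions start afresh in each of these \<open>p\<close> classes. All of them
  contribute the sum of products, whereas the excess over \<open>max s1 s2\<close> is collected only
  in the class of the point at which the valuations of both f and g are large. Integrality of the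
  weights is what brings in integral resolutions: a class whose paths still need a given total has
  an integer weight, and this is at least the first term of the integral minimal resolution. The
  obstacle is that a larger weight at one node lowers what is needed in all \<open>p\<close>
  subtrees below it. The constraint between consecutive terms of a resolution shows that this saving
  never exceeds the gain at the node itself. The valuation comes from Zorn's lemma, in the manner of
  Chevalley's extension theorem: a subring of the complex numbers that is maximal among those
  containing p but not 1/p is a valuation ring, and it contains every algebraic integer.\<close>

text \<open>The largest total of an integral resolution that starts with \<open>n\<close>.\<close>

function tower :: "nat \<Rightarrow> nat \<Rightarrow> nat" where
  "tower p n = (if p < 2 \<or> n = 0 then n else n + tower p (n div p))"
  by pat_completeness auto
termination
  by (relation "Wellfounded.measure snd") auto

declare tower.simps [simp del]

text \<open>The least possible first term of an integral resolution of \<open>w\<close>, since a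
  resolution that starts with \<open>m\<close> has total at most \<open>tower p m\<close>.\<close>

definition head :: "nat \<Rightarrow> nat \<Rightarrow> nat" where
  "head p w = (LEAST m. w \<le> tower p m)"

text \<open>Each term is the least one possible for what remains. The constraint between consecutive
  terms is not imposed; it follows from \<open>head_rest\<close>.\<close>

fun greedy :: "nat \<Rightarrow> nat \<Rightarrow> nat \<Rightarrow> nat" where
  "greedy p w 0 = head p w"
| "greedy p w (Suc i) = greedy p (w - head p w) i"

text \<open>The sum in the theorem without its factor \<open>p\<close>. All terms from index
  \<open>a\<close> on vanish, so the value is symmetric in \<open>a\<close> and
  \<open>b\<close>.\<close>

definition pairing :: "nat \<Rightarrow> nat \<Rightarrow> nat \<Rightarrow> nat" where
  "pairing p a b = (\<Sum>i<a. p ^ i * greedy p a i * greedy p b i)"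

lemma tower_ge: "n \<le> tower p n"
  by (subst tower.simps) auto

lemma tower_0 [simp]: "tower p 0 = 0"
  by (subst tower.simps) auto

lemma tower_rec: "2 \<le> p \<Longrightarrow> tower p n = n + tower p (n div p)"
  by (subst tower.simps) auto

text \<open>The slope of \<open>tower p\<close> is at least 1; hence \<open>head\<close> rises by at
  most 1 when its argument does.\<close>

lemma tower_add_le:
  assumes "2 \<le> p" "m \<le> n"
  shows "tower p m + (n - m) \<le> tower p n"
  using assms(2)
proof (induction n arbitrary: m rule: less_induct)
  case (less n)
  show ?case
  proof (cases "n = 0")
    case False
    have "tower p (m div p) + (n div p - m div p) \<le> tower p (n div p)"
      using less False assms(1) by (intro less.IH) (auto simp: div_le_mono)
    then show ?thesis
      using tower_rec[OF assms(1), of n] tower_rec[OF assms(1), of m] less.prems by linarith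
  qed (use less in auto)
qed

lemma tower_mono: "2 \<le> p \<Longrightarrow> m \<le> n \<Longrightarrow> tower p m \<le> tower p n"
  using tower_add_le[of p m n] by linarith

lemma le_tower_head: "w \<le> tower p (head p w)"
  unfolding head_def by (rule LeastI[of _ w]) (rule tower_ge)

lemma head_le: "w \<le> tower p m \<Longrightarrow> head p w \<le> m"
  unfolding head_def by (rule Least_le)

lemma head_le_self: "head p w \<le> w"
  by (intro head_le tower_ge)

lemma head_0 [simp]: "head p 0 = 0"
  using head_le_self[of p 0] by simp

lemma head_mono: "v \<le> w \<Longrightarrow> head p v \<le> head p w"
  by (intro head_le order.trans[OF _ le_tower_head])

lemma head_pos: "w > 0 \<Longrightarrow> head p w > 0"
  using le_tower_head[of w p] by (cases "head p w") auto

lemma head_Suc: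
  assumes "2 \<le> p"
  shows "head p (Suc w) = head p w \<or> head p (Suc w) = Suc (head p w)"
proof -
  have "Suc w \<le> tower p (Suc (head p w))"
    using tower_add_le[OF assms, of "head p w" "Suc (head p w)"] le_tower_head[of w p] by simp
  then have "head p (Suc w) \<le> Suc (head p w)"
    by (rule head_le)
  then show ?thesis
    using head_mono[of w "Suc w" p] by linarith
qed

text \<open>By the recursion for \<open>tower\<close>, what remains after the head is at most
  \<open>tower p (head p w div p)\<close>. This yields the resolution constraint for
  \<open>greedy\<close>, and it is the estimate that keeps deviations from paying.\<close>

lemma head_rest:
  assumes "2 \<le> p"
  shows "p * head p (w - head p w) \<le> head p w"
proof -
  have "w - head p w \<le> tower p (head p w div p)"
    using tower_rec[OF assms, of "head p w"] le_tower_head[of w p] by linarith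
  then have "head p (w - head p w) \<le> head p w div p"
    by (rule head_le)
  then show ?thesis
    by (metis mult_le_mono2 order.trans times_div_less_eq_dividend)
qed

lemma greedy_0 [simp]: "greedy p 0 i = 0"
  by (induction i) auto

lemma greedy_eq_0: "w \<le> i \<Longrightarrow> greedy p w i = 0"
proof (induction i arbitrary: w)
  case (Suc i)
  then show ?case
    using head_pos[of w p] by (cases "w = 0") auto
qed auto

lemma greedy_antimono:
  assumes "2 \<le> p"
  shows "p * greedy p w (Suc i) \<le> greedy p w i"
proof (induction i arbitrary: w)
  case (Suc i)
  show ?case
    using Suc.IH[of "w - head p w"] by (simp only: greedy.simps)
qed (use head_rest[OF assms] in auto)

lemma sum_greedy: "(\<Sum>i<w. greedy p w i) = w"
proof (induction w rule: less_induct)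
  case (less w)
  show ?case
  proof (cases w)
    case (Suc v)
    define w' where "w' = w - head p w"
    have w': "w' \<le> v" "w' < w"
      using head_pos[of w p] Suc by (auto simp: w'_def)
    have "(\<Sum>i<w. greedy p w i) = head p w + (\<Sum>i<v. greedy p w' i)"
      unfolding Suc sum.lessThan_Suc_shift by (simp add: w'_def Suc)
    also have "(\<Sum>i<v. greedy p w' i) = (\<Sum>i<w'. greedy p w' i)"
      using w' by (intro sum.mono_neutral_right) (auto simp: greedy_eq_0)
    also have "\<dots> = w'"
      by (rule less.IH) (rule w')
    finally show ?thesis
      using head_le_self[of p w] by (simp add: w'_def)
  qed auto
qed

lemma integral_resolution_greedy:
  assumes "2 \<le> p"
  shows "integral_resolution p w (greedy p w)"
proof -
  have sub: "{i. greedy p w i \<noteq> 0} \<subseteq> {..<w}"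
  proof
    fix i assume "i \<in> {i. greedy p w i \<noteq> 0}"
    then show "i \<in> {..<w}"
      using greedy_eq_0[of w i p] by (cases "w \<le> i") auto
  qed
  have "(\<Sum>i\<in>{i. greedy p w i \<noteq> 0}. greedy p w i) = (\<Sum>i<w. greedy p w i)"
    using sub by (intro sum.mono_neutral_left) auto
  then show ?thesis
    using sub assms greedy_antimono sum_greedy finite_subset[OF sub]
    unfolding integral_resolution_def by auto
qed

lemma integral_resolution_tail:
  assumes "integral_resolution p w d"
  shows "integral_resolution p (w - d 0) (\<lambda>i. d (Suc i))" "d 0 \<le> w"
proof -
  let ?S = "{i. d i \<noteq> 0}" and ?T = "{i. d (Suc i) \<noteq> 0}"
  have fin: "finite ?S" and sum: "sum d ?S = w"
    using assms by (auto simp: integral_resolution_def)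
  have im: "Suc ` ?T = ?S - {0}"
  proof safe
    fix i assume "d i > 0" "i \<notin> Suc ` ?T"
    then show "i = 0" by (cases i) auto
  qed
  have finT: "finite ?T"
    by (rule finite_imageD[of Suc]) (use fin im in auto)
  have "(\<Sum>i\<in>?T. d (Suc i)) = sum d (Suc ` ?T)"
    by (subst sum.reindex) auto
  also have "d 0 + \<dots> = sum d ?S"
    unfolding im using fin by (cases "d 0 = 0") (auto simp: sum.remove[of _ 0])
  finally have *: "d 0 + (\<Sum>i\<in>?T. d (Suc i)) = w"
    using sum by simp
  then show "integral_resolution p (w - d 0) (\<lambda>i. d (Suc i))" "d 0 \<le> w"
    using assms finT unfolding integral_resolution_def by auto
qed

lemma integral_resolution_zero:
  assumes "integral_resolution p 0 d"
  shows "d i = 0"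
proof -
  have "\<forall>i\<in>{i. d i \<noteq> 0}. d i = 0"
    using assms unfolding integral_resolution_def by (metis (no_types, lifting) sum_eq_0_iff)
  then show ?thesis by auto
qed

text \<open>Each term is at most the floor of its predecessor divided by \<open>p\<close>, and
  \<open>tower\<close> adds up exactly these iterated floors.\<close>

lemma integral_resolution_le_tower:
  assumes "2 \<le> p" "integral_resolution p w d"
  shows "w \<le> tower p (d 0)"
  using assms(2)
proof (induction w arbitrary: d rule: less_induct)
  case (less w)
  note tail = integral_resolution_tail[OF less.prems]
  show ?case
  proof (cases "d 0 = 0")
    case True
    have "d i = 0" for i
    proof (induction i)
      case (Suc i)
      have "p * d (Suc i) \<le> d i"
        using less.prems by (auto simp: integral_resolution_def)
      then show ?case using Suc assms(1) by auto
    qed (rule True)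
    then show ?thesis
      using less.prems by (auto simp: integral_resolution_def)
  next
    case False
    then have "w - d 0 \<le> tower p (d (Suc 0))"
      using tail by (intro less.IH) auto
    also have "d (Suc 0) * p \<le> d 0"
      using less.prems by (auto simp: integral_resolution_def mult.commute)
    then have "d (Suc 0) \<le> d 0 div p"
      using assms(1) by (simp add: less_eq_div_iff_mult_less_eq)
    then have "tower p (d (Suc 0)) \<le> tower p (d 0 div p)"
      by (rule tower_mono[OF assms(1)])
    finally show ?thesis
      using tower_rec[OF assms(1), of "d 0"] by linarith
  qed
qed

text \<open>The first term of any resolution is at least \<open>head p w\<close>. If it is equal,
  both tails resolve the same remaining total and the induction compares them.\<close>

lemma greedy_lex_least:
  assumes "2 \<le> p" "integral_resolution p w d" "d \<noteq> greedy p w"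
  shows "lex_less (greedy p w) d"
  using assms(2,3)
proof (induction w arbitrary: d rule: less_induct)
  case (less w)
  have le: "head p w \<le> d 0"
    by (rule head_le) (rule integral_resolution_le_tower[OF assms(1) less.prems(1)])
  have "w \<noteq> 0"
    using less.prems integral_resolution_zero[of p d] by (intro notI) (auto simp: fun_eq_iff)
  show ?case
  proof (cases "d 0 = head p w")
    case True
    have "\<exists>i. d (Suc i) \<noteq> greedy p (w - head p w) i"
    proof (rule ccontr)
      assume "\<not> ?thesis"
      then have "d i = greedy p w i" for i
        using True by (cases i) auto
      then show False using less.prems by auto
    qed
    then have "lex_less (greedy p (w - head p w)) (\<lambda>i. d (Suc i))"
      using integral_resolution_tail(1)[OF less.prems(1)] True head_pos[of w p] \<open>w \<noteq> 0\<close>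
      by (intro less.IH) (auto simp: fun_eq_iff)
    then obtain k where k: "\<forall>i<k. greedy p (w - head p w) i = d (Suc i)"
        "greedy p (w - head p w) k < d (Suc k)"
      unfolding lex_less_def by blast
    have "greedy p w i = d i" if "i < Suc k" for i
      using that k True by (cases i) auto
    then show ?thesis
      using k unfolding lex_less_def by (intro exI[of _ "Suc k"]) auto
  next
    case False
    then show ?thesis
      using le unfolding lex_less_def by (intro exI[of _ 0]) auto
  qed
qed

lemma lex_less_asym: "lex_less g d \<Longrightarrow> \<not> lex_less d g"
  unfolding lex_less_def by (metis less_asym less_irrefl linorder_neqE_nat)

lemma min_resolution_eq_greedy:
  assumes "2 \<le> p"
  shows "min_resolution p w = greedy p w"
  unfolding min_resolution_def
proof (rule the_equality)
  show "integral_resolution p w (greedy p w) \<and>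
    (\<forall>\<delta>. integral_resolution p w \<delta> \<and> \<delta> \<noteq> greedy p w \<longrightarrow> lex_less (greedy p w) \<delta>)"
    using assms integral_resolution_greedy greedy_lex_least by blast
next
  fix g assume "integral_resolution p w g \<and>
    (\<forall>\<delta>. integral_resolution p w \<delta> \<and> \<delta> \<noteq> g \<longrightarrow> lex_less g \<delta>)"
  then show "g = greedy p w"
    using assms integral_resolution_greedy greedy_lex_least lex_less_asym by metis
qed

section \<open>The sum of products of two minimal resolutions\<close>

lemma pairing_eq_sum:
  assumes "a \<le> n \<or> b \<le> n"
  shows "pairing p a b = (\<Sum>i<n. p ^ i * greedy p a i * greedy p b i)"
proof -
  let ?f = "\<lambda>i. p ^ i * greedy p a i * greedy p b i"
  have "pairing p a b = sum ?f {..<max a n}"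
    unfolding pairing_def by (intro sum.mono_neutral_left) (auto simp: greedy_eq_0)
  also have "\<dots> = sum ?f {..<n}"
    using assms by (intro sum.mono_neutral_right) (auto simp: greedy_eq_0)
  finally show ?thesis .
qed

lemma pairing_commute: "pairing p a b = pairing p b a"
  unfolding pairing_eq_sum[of a "max a b" b p, OF disjI1[OF max.cobounded1]]
    pairing_eq_sum[of b "max a b" a p, OF disjI1[OF max.cobounded2]]
  by (intro sum.cong) auto

lemma pairing_0 [simp]: "pairing p 0 b = 0" "pairing p b 0 = 0"
  by (auto simp: pairing_def)

lemma pairing_rec:
  "pairing p a b = head p a * head p b + p * pairing p (a - head p a) (b - head p b)"
proof -
  have "pairing p a b = (\<Sum>i<Suc a. p ^ i * greedy p a i * greedy p b i)"
    by (rule pairing_eq_sum) auto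
  also have "\<dots> = head p a * head p b + p * (\<Sum>i<a. p ^ i * greedy p (a - head p a) i
      * greedy p (b - head p b) i)"
    unfolding sum.lessThan_Suc_shift sum_distrib_left by (simp add: mult.assoc)
  also have "(\<Sum>i<a. p ^ i * greedy p (a - head p a) i * greedy p (b - head p b) i)
      = pairing p (a - head p a) (b - head p b)"
    by (rule pairing_eq_sum[symmetric]) auto
  finally show ?thesis .
qed

text \<open>Either the head of \<open>a\<close> grows and the rest stays, a gain of exactly
  \<open>head p b\<close>; or the head stays and the rest grows by one, which by induction gains at
  most \<open>p * head p (b - head p b)\<close>, again at most \<open>head p b\<close>.\<close>

lemma pairing_Suc:
  assumes "2 \<le> p"
  shows "pairing p (Suc a) b \<le> pairing p a b + head p b"
proof (induction a arbitrary: b rule: less_induct)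
  case (less a)
  show ?case
  proof (cases "head p (Suc a) = Suc (head p a)")
    case True
    then show ?thesis
      using pairing_rec[of p "Suc a" b] pairing_rec[of p a b] by simp
  next
    case False
    then have eq: "head p (Suc a) = head p a"
      using head_Suc[OF assms, of a] by blast
    have pos: "head p a > 0"
      using head_pos[of "Suc a" p] eq by simp
    then have "a > 0"
      using head_le_self[of p a] by linarith
    have "pairing p (Suc (a - head p a)) (b - head p b)
        \<le> pairing p (a - head p a) (b - head p b) + head p (b - head p b)"
      using pos \<open>a > 0\<close> by (intro less.IH) auto
    then have "p * pairing p (Suc (a - head p a)) (b - head p b)
        \<le> p * (pairing p (a - head p a) (b - head p b) + head p (b - head p b))"
      by (rule mult_le_mono2)
    also have "\<dots> \<le> p * pairing p (a - head p a) (b - head p b) + head p b"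
      using head_rest[OF assms, of b] by (simp add: distrib_left)
    finally show ?thesis
      using pairing_rec[of p "Suc a" b] pairing_rec[of p a b] eq head_le_self[of p a]
      by (simp add: Suc_diff_le)
  qed
qed

lemma pairing_step:
  assumes "2 \<le> p" "head p b \<le> B"
  shows "A * B + p * pairing p (a - A) (b - B)
      \<le> Suc A * B + p * pairing p (a - Suc A) (b - B)"
proof (cases "A < a")
  case True
  then have "a - A = Suc (a - Suc A)" by simp
  then have "pairing p (a - A) (b - B) \<le> pairing p (a - Suc A) (b - B) + head p (b - B)"
    using pairing_Suc[OF assms(1), of "a - Suc A" "b - B"] by simp
  \<comment> \<open>As \<open>head p b \<le> B\<close>, the loss is at most
    \<open>p * head p (b - head p b)\<close>, hence at most \<open>head p b\<close> and so at most
    \<open>B\<close>, which is the gain from one more unit of \<open>A\<close>.\<close>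
  also have "head p (b - B) \<le> head p (b - head p b)"
    using assms(2) by (intro head_mono) auto
  finally have "p * pairing p (a - A) (b - B)
      \<le> p * (pairing p (a - Suc A) (b - B) + head p (b - head p b))"
    by simp
  then show ?thesis
    using head_rest[OF assms(1), of b] assms(2) by (simp add: distrib_left)
qed auto

lemma pairing_mono_left:
  assumes "2 \<le> p" "head p b \<le> B" "A \<le> A'"
  shows "A * B + p * pairing p (a - A) (b - B) \<le> A' * B + p * pairing p (a - A') (b - B)"
  using assms(3)
proof (induction rule: dec_induct)
  case (step n)
  then show ?case
    using pairing_step[OF assms(1,2), of n a] by linarith
qed simp

text \<open>The two coordinates move one after the other: \<open>a\<close> gives up
  \<open>A'\<close> while \<open>b\<close> still gives up its head, then \<open>b\<close> moves on
  to \<open>B\<close>. Each move is an instance of \<open>pairing_mono_left\<close>, up to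
  symmetry.\<close>

lemma pairing_excess_left:
  assumes "2 \<le> p" "head p a \<le> A" "head p b \<le> B" "B \<ge> 1"
  shows "pairing p a b + (A - a) \<le> A * B + p * pairing p (a - A) (b - B)"
proof -
  \<comment> \<open>Beyond \<open>a\<close> the remainder \<open>a - A\<close> stays 0, so each
    further unit of \<open>A\<close> adds \<open>B \<ge> 1\<close> at no cost; this is the source of
    the excess \<open>A - a\<close>.\<close>
  define A' where "A' = min A a"
  have A': "head p a \<le> A'"
    using assms(2) head_le_self[of p a] by (simp add: A'_def)
  have "pairing p a b \<le> head p b * A' + p * pairing p (b - head p b) (a - A')"
    using pairing_mono_left[OF assms(1) order.refl A', of b "head p b"] pairing_rec[of p a b]
      pairing_mono_left[OF assms(1) order.refl A', where a = a and b = b]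
    by (simp add: pairing_commute mult.commute)
  also have "\<dots> \<le> B * A' + p * pairing p (b - B) (a - A')"
    by (rule pairing_mono_left[OF assms(1) A' assms(3)])
  also have "\<dots> + (A - a) \<le> A * B + p * pairing p (a - A) (b - B)"
  proof (cases "A \<le> a")
    case False
    then obtain k where "A = a + k"
      using le_Suc_ex[of a A] by auto
    then show ?thesis
      using assms(4) by (simp add: A'_def algebra_simps)
  qed (simp add: A'_def pairing_commute mult.commute)
  finally show ?thesis by simp
qed

text \<open>Moving \<open>A\<close> away from its least possible value gains \<open>B\<close> and costs at most
  \<open>p * head p (b - B) \<le> B\<close>; beyond \<open>a\<close> it costs nothing.\<close>

lemma pairing_excess:
  assumes "2 \<le> p" "head p a \<le> A" "head p b \<le> B" "A \<ge> 1" "B \<ge> 1"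
  shows "pairing p a b + max (A - a) (B - b) \<le> A * B + p * pairing p (a - A) (b - B)"
  using pairing_excess_left[OF assms(1-3,5)] pairing_excess_left[OF assms(1,3,2,4)]
  by (auto simp: pairing_commute mult.commute max_def)

section \<open>Weights on the p-adic tree\<close>

primrec tree_sum :: "nat \<Rightarrow> (nat \<Rightarrow> int \<Rightarrow> 'a) \<Rightarrow> nat \<Rightarrow> nat \<Rightarrow> int \<Rightarrow> 'a :: comm_monoid_add" where
  "tree_sum p F 0 k n = 0"
| "tree_sum p F (Suc d) k n =
     F k n + (\<Sum>c<p. tree_sum p F d (Suc k) (n + int c * int p ^ k))"

text \<open>The nodes of level \<open>k\<close> of the \<open>p\<close>-adic tree are the residue classes modulo \<open>p ^ k\<close>,
  given by representatives.\<close>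

definition tree_weight :: "nat \<Rightarrow> (nat \<Rightarrow> int \<Rightarrow> nat) \<Rightarrow> bool" where
  "tree_weight p \<phi> \<longleftrightarrow>
     (\<forall>k m n. [m = n] (mod int p ^ k) \<longrightarrow> \<phi> k m = \<phi> k n) \<and>
     (\<forall>k n. (\<Sum>c<p. \<phi> (Suc k) (n + int c * int p ^ k)) \<le> \<phi> k n)"

lemma tree_weight_cong: "tree_weight p \<phi> \<Longrightarrow> [m = n] (mod int p ^ k) \<Longrightarrow> \<phi> k m = \<phi> k n"
  by (simp add: tree_weight_def)

lemma cong_child:
  assumes "[m = n + c * int p ^ k] (mod int p ^ Suc k)"
  shows "[m = n] (mod int p ^ k)"
proof -
  have "[m = n + c * int p ^ k] (mod int p ^ k)"
    using assms by (rule cong_dvd_modulus) simp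
  then show ?thesis
    by (simp add: cong_def)
qed

lemma ex_child:
  assumes "2 \<le> p" "[m = n] (mod int p ^ k)"
  obtains c where "c < p" "[m = n + int c * int p ^ k] (mod int p ^ Suc k)"
proof -
  from assms(2) obtain z where z: "m = n + int p ^ k * z"
    using cong_iff_lin[of n m "int p ^ k"] by (auto simp: cong_sym_eq)
  define c where "c = nat (z mod int p)"
  have c: "int c = z mod int p" "c < p"
    using assms(1) by (auto simp: c_def nat_less_iff)
  define q where "q = z div int p"
  have zq: "z = int p * q + int c"
    by (simp add: c(1) q_def)
  have "m - (n + int c * int p ^ k) = int p ^ Suc k * q"
    unfolding z zq by (simp add: algebra_simps)
  then have "[m = n + int c * int p ^ k] (mod int p ^ Suc k)"
    by (metis cong_iff_dvd_diff dvd_triv_left)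
  with c show thesis using that by blast
qed

lemma tree_weight_Suc_le:
  assumes "2 \<le> p" "tree_weight p \<phi>"
  shows "\<phi> (Suc k) n \<le> \<phi> k n"
proof -
  obtain c where c: "c < p" "[n = n + int c * int p ^ k] (mod int p ^ Suc k)"
    using ex_child[OF assms(1) cong_refl] by blast
  have "\<phi> (Suc k) n = \<phi> (Suc k) (n + int c * int p ^ k)"
    by (rule tree_weight_cong[OF assms(2) c(2)])
  also have "\<dots> \<le> (\<Sum>c<p. \<phi> (Suc k) (n + int c * int p ^ k))"
    using c(1) by (intro member_le_sum) auto
  also have "\<dots> \<le> \<phi> k n"
    using assms(2) by (simp add: tree_weight_def)
  finally show ?thesis .
qed

lemma tree_weight_add_le:
  assumes "2 \<le> p" "tree_weight p \<phi>"
  shows "\<phi> (k + j) n \<le> \<phi> k n"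
proof (induction j)
  case (Suc j)
  then show ?case
    using tree_weight_Suc_le[OF assms, of "k + j" n] by simp
qed simp

text \<open>Following a lightest child downwards, the weight drops at least by the factor
  \<open>p\<close> with rounding down, so the path collects at most \<open>tower p\<close> of the
  first weight.\<close>

lemma path_le_tower:
  assumes "2 \<le> p" "tree_weight p \<phi>"
    and "\<And>m. [m = n] (mod int p ^ k) \<Longrightarrow> a \<le> (\<Sum>j<d. \<phi> (k + j) m)"
  shows "a \<le> tower p (\<phi> k n)"
  using assms(3)
proof (induction d arbitrary: k n a)
  case 0
  then show ?case by (simp add: cong_def)
next
  case (Suc d)
  have "\<exists>c<p. \<phi> (Suc k) (n + int c * int p ^ k) \<le> \<phi> k n div p"
  proof (rule ccontr)
    assume "\<not> ?thesis"
    then have "(\<Sum>c<p. Suc (\<phi> k n div p)) \<le> (\<Sum>c<p. \<phi> (Suc k) (n + int c * int p ^ k))"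
      by (intro sum_mono) (auto simp: not_le Suc_le_eq)
    also have "\<dots> \<le> \<phi> k n"
      using assms(2) by (simp add: tree_weight_def)
    finally show False
      using assms(1) dividend_less_times_div[of p "\<phi> k n"] by simp
  qed
  then obtain c where c: "c < p" "\<phi> (Suc k) (n + int c * int p ^ k) \<le> \<phi> k n div p"
    by blast
  have "a - \<phi> k n \<le> tower p (\<phi> (Suc k) (n + int c * int p ^ k))"
  proof (rule Suc.IH)
    fix m assume "[m = n + int c * int p ^ k] (mod int p ^ Suc k)"
    then have m: "[m = n] (mod int p ^ k)" by (rule cong_child)
    then have "a \<le> (\<Sum>j<Suc d. \<phi> (k + j) m)"
      by (rule Suc.prems)
    also have "\<dots> = \<phi> k n + (\<Sum>j<d. \<phi> (Suc k + j) m)"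
      unfolding sum.lessThan_Suc_shift using tree_weight_cong[OF assms(2) m] by simp
    finally show "a - \<phi> k n \<le> (\<Sum>j<d. \<phi> (Suc k + j) m)" by simp
  qed
  also have "\<dots> \<le> tower p (\<phi> k n div p)"
    by (rule tower_mono[OF assms(1) c(2)])
  finally show ?case
    using tower_rec[OF assms(1), of "\<phi> k n"] by linarith
qed

text \<open>For the children of a node: all of them satisfy the basic bound, but only the child on
  the distinguished path passes on an excess.\<close>

lemma sum_ge_with_excess:
  fixes f :: "'a \<Rightarrow> nat"
  assumes "finite A" "c \<in> A" "\<And>x. x \<in> A \<Longrightarrow> e \<le> f x" "e + u \<le> f c"
  shows "card A * e + u \<le> sum f A"
proof -
  have "(\<Sum>x\<in>A. e + (if x = c then u else 0)) \<le> sum f A"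
    using assms by (intro sum_mono) auto
  then show ?thesis
    using assms(1,2) by (simp add: sum.distrib)
qed

text \<open>The excess is kept as the minimum of two separate excesses: the single quantity
  \<open>S - max a b\<close> is not inherited by subtrees.\<close>

theorem tree_sum_ge:
  assumes p: "2 \<le> p" and wt: "tree_weight p \<phi>" "tree_weight p \<psi>"
    and "\<And>m. [m = n] (mod int p ^ k) \<Longrightarrow> a \<le> (\<Sum>j<d. \<phi> (k + j) m)"
    and "\<And>m. [m = n] (mod int p ^ k) \<Longrightarrow> b \<le> (\<Sum>j<d. \<psi> (k + j) m)"
    and "[l = n] (mod int p ^ k)"
  shows "pairing p a b + min ((\<Sum>j<d. \<phi> (k + j) l) - a) ((\<Sum>j<d. \<psi> (k + j) l) - b)
      \<le> tree_sum p (\<lambda>k n. \<phi> k n * \<psi> k n) d k n"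
  using assms(4-)
proof (induction d arbitrary: k n a b l)
  case 0
  then show ?case by (auto simp: cong_def)
next
  case (Suc d)
  define A B where "A = \<phi> k n" and "B = \<psi> k n"
  define U V where "U = (\<Sum>j<d. \<phi> (Suc k + j) l)" and "V = (\<Sum>j<d. \<psi> (Suc k + j) l)"
  define T where "T c = tree_sum p (\<lambda>k n. \<phi> k n * \<psi> k n) d (Suc k) (n + int c * int p ^ k)" for c
  have split: "(\<Sum>j<Suc d. \<phi> (k + j) m) = A + (\<Sum>j<d. \<phi> (Suc k + j) m)"
      "(\<Sum>j<Suc d. \<psi> (k + j) m) = B + (\<Sum>j<d. \<psi> (Suc k + j) m)"
    if "[m = n] (mod int p ^ k)" for m
    unfolding sum.lessThan_Suc_shift A_def B_def
    using tree_weight_cong[OF wt(1) that] tree_weight_cong[OF wt(2) that] by simp_all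
  have UV: "(\<Sum>j<Suc d. \<phi> (k + j) l) = A + U" "(\<Sum>j<Suc d. \<psi> (k + j) l) = B + V"
    using split[OF Suc.prems(3)] by (simp_all add: U_def V_def)
  have le: "a \<le> A + U" "b \<le> B + V"
    using Suc.prems(1,2)[OF Suc.prems(3)] by (simp_all only: UV)
  have U0: "U = 0" if "A = 0"
  proof -
    have "\<phi> (Suc k + j) l = 0" for j
      using tree_weight_add_le[OF p wt(1), of k "Suc j" l] tree_weight_cong[OF wt(1) Suc.prems(3)] that
      by (simp add: A_def)
    then show ?thesis by (simp add: U_def)
  qed
  have V0: "V = 0" if "B = 0"
  proof -
    have "\<psi> (Suc k + j) l = 0" for j
      using tree_weight_add_le[OF p wt(2), of k "Suc j" l] tree_weight_cong[OF wt(2) Suc.prems(3)] that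
      by (simp add: B_def)
    then show ?thesis by (simp add: V_def)
  qed
  have IH: "pairing p (a - A) (b - B)
      + min ((\<Sum>j<d. \<phi> (Suc k + j) m) - (a - A)) ((\<Sum>j<d. \<psi> (Suc k + j) m) - (b - B)) \<le> T c"
    if "[m = n + int c * int p ^ k] (mod int p ^ Suc k)" for m c
    unfolding T_def
  proof (rule Suc.IH)
    fix m assume "[m = n + int c * int p ^ k] (mod int p ^ Suc k)"
    then have m: "[m = n] (mod int p ^ k)" by (rule cong_child)
    show "a - A \<le> (\<Sum>j<d. \<phi> (Suc k + j) m)" "b - B \<le> (\<Sum>j<d. \<psi> (Suc k + j) m)"
      using Suc.prems(1,2)[OF m] unfolding split[OF m] by simp_all
  qed (rule that)
  obtain c where c: "c < p" "[l = n + int c * int p ^ k] (mod int p ^ Suc k)"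
    using ex_child[OF p Suc.prems(3)] by blast
  have "card {..<p} * pairing p (a - A) (b - B) + min (U - (a - A)) (V - (b - B)) \<le> sum T {..<p}"
  proof (rule sum_ge_with_excess)
    show "pairing p (a - A) (b - B) \<le> T x" for x
      using IH[OF cong_refl, of x] by linarith
    show "pairing p (a - A) (b - B) + min (U - (a - A)) (V - (b - B)) \<le> T c"
      using IH[OF c(2)] by (simp add: U_def V_def)
  qed (use c in auto)
  then have T: "p * pairing p (a - A) (b - B) + min (U - (a - A)) (V - (b - B)) \<le> sum T {..<p}"
    by simp
  have goal: "pairing p a b + min (A + U - a) (B + V - b) \<le> A * B + sum T {..<p}"
  proof (cases "A = 0 \<or> B = 0")
    \<comment> \<open>A vanishing weight vanishes on the whole subtree, so the corresponding need is
      0; then both the pairing and the minimum of the excesses are 0.\<close>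
    case True
    then show ?thesis using U0 V0 le by auto
  next
    case False
    have "head p a \<le> A" "head p b \<le> B"
      unfolding A_def B_def
      using path_le_tower[OF p wt(1) Suc.prems(1)] path_le_tower[OF p wt(2) Suc.prems(2)]
      by (auto intro: head_le)
    then have "pairing p a b + max (A - a) (B - b) \<le> A * B + p * pairing p (a - A) (b - B)"
      using False by (intro pairing_excess[OF p]) auto
    \<comment> \<open>The truncated differences split exactly because \<open>a \<le> A + U\<close>
      and \<open>b \<le> B + V\<close>. A minimum of sums is at most the maximum of the first
      summands plus the minimum of the second; this is why \<open>pairing_excess\<close> must supply
      a maximum.\<close>
    moreover have "A + U - a = (A - a) + (U - (a - A))" "B + V - b = (B - b) + (V - (b - B))"
      using le by linarith+
    then have "min (A + U - a) (B + V - b)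
        \<le> max (A - a) (B - b) + min (U - (a - A)) (V - (b - B))"
      by (auto simp: min_def max_def)
    ultimately show ?thesis using T by linarith
  qed
  then show ?case
    unfolding UV by (simp add: A_def B_def T_def)
qed

section \<open>Extending the \<open>p\<close>-adic norm\<close>

locale subring =
  fixes R :: "'a :: field set"
  assumes one_mem: "1 \<in> R"
    and diff_mem: "x \<in> R \<Longrightarrow> y \<in> R \<Longrightarrow> x - y \<in> R"
    and mult_mem: "x \<in> R \<Longrightarrow> y \<in> R \<Longrightarrow> x * y \<in> R"
begin

lemma zero_mem: "0 \<in> R"
  using diff_mem[OF one_mem one_mem] by simp

lemma uminus_mem: "x \<in> R \<Longrightarrow> - x \<in> R"
  using diff_mem[OF zero_mem, of x] by simp

lemma add_mem: "x \<in> R \<Longrightarrow> y \<in> R \<Longrightarrow> x + y \<in> R"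
  using diff_mem[OF _ uminus_mem, of x y] by simp

lemma sum_mem: "(\<And>i. i \<in> A \<Longrightarrow> f i \<in> R) \<Longrightarrow> sum f A \<in> R"
  by (induction A rule: infinite_finite_induct) (auto intro: zero_mem add_mem)

lemma power_mem: "x \<in> R \<Longrightarrow> x ^ n \<in> R"
  by (induction n) (auto intro: one_mem mult_mem)

lemma of_nat_mem: "of_nat n \<in> R"
  by (induction n) (auto intro: zero_mem add_mem one_mem)

lemma of_int_mem: "of_int n \<in> R"
  by (cases n rule: int_cases2) (auto intro: of_nat_mem uminus_mem)

lemma subring_adjoin: "subring {poly q x | q. \<forall>i. coeff q i \<in> R}"
proof
  show "1 \<in> {poly q x | q. \<forall>i. coeff q i \<in> R}"
    by (intro CollectI exI[of _ 1]) (auto simp: one_mem zero_mem)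
next
  fix y z assume "y \<in> {poly q x | q. \<forall>i. coeff q i \<in> R}" "z \<in> {poly q x | q. \<forall>i. coeff q i \<in> R}"
  then obtain q r where qr: "y = poly q x" "z = poly r x" "\<And>i. coeff q i \<in> R" "\<And>i. coeff r i \<in> R"
    by blast
  show "y - z \<in> {poly q x | q. \<forall>i. coeff q i \<in> R}"
    by (intro CollectI exI[of _ "q - r"]) (auto simp: qr diff_mem)
  show "y * z \<in> {poly q x | q. \<forall>i. coeff q i \<in> R}"
    by (intro CollectI exI[of _ "q * r"]) (auto simp: qr coeff_mult intro!: sum_mem mult_mem)
qed

end

section \<open>Maximal subrings without 1/p are valuation rings\<close>

locale maximal_subring = subring R for R :: "'a :: field set" +
  fixes p :: 'a
  assumes p_mem: "p \<in> R" and p_nonzero: "p \<noteq> 0" and inverse_p_notin: "inverse p \<notin> R"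
    and maximal: "subring S \<Longrightarrow> R \<subseteq> S \<Longrightarrow> inverse p \<notin> S \<Longrightarrow> S = R"
begin

text \<open>A witness, of degree at most \<open>n\<close>, that the inverse of \<open>p\<close> lies
  in the ring generated by \<open>x\<close> over \<open>R\<close>. By maximality every
  \<open>x\<close> outside \<open>R\<close> has one.\<close>

definition p_relation :: "'a \<Rightarrow> nat \<Rightarrow> bool" where
  "p_relation x n \<longleftrightarrow> (\<exists>a. (\<forall>i. a i \<in> R) \<and> p * (\<Sum>i\<le>n. a i * x ^ i) = 1)"

lemma ex_p_relation:
  assumes "x \<notin> R"
  shows "\<exists>n. p_relation x n"
proof -
  let ?S = "{poly q x | q. \<forall>i. coeff q i \<in> R}"
  have "x = poly [:0, 1:] x" "\<forall>i. coeff [:0, 1:] i \<in> R"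
    by (auto simp: coeff_pCons zero_mem one_mem split: nat.splits)
  then have "x \<in> ?S" by blast
  moreover have "R \<subseteq> ?S"
  proof
    fix r assume "r \<in> R"
    then have "r = poly [:r:] x" "\<forall>i. coeff [:r:] i \<in> R"
      by (auto simp: coeff_pCons zero_mem split: nat.splits)
    then show "r \<in> ?S" by blast
  qed
  ultimately have "inverse p \<in> ?S"
    using maximal[OF subring_adjoin] assms by blast
  then obtain q where q: "inverse p = poly q x" "\<And>i. coeff q i \<in> R"
    by blast
  have "p * (\<Sum>i\<le>degree q. coeff q i * x ^ i) = 1"
    using p_nonzero q(1) by (simp flip: poly_altdef q(1))
  then show ?thesis
    using q(2) unfolding p_relation_def by (intro exI[of _ "degree q"] exI[of _ "coeff q"]) auto
qed

lemma not_p_multiple_1: "r \<in> R \<Longrightarrow> p * r \<noteq> 1"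
  using inverse_p_notin by (metis inverse_unique)

text \<open>If the inverse of \<open>u = 1 - p * b\<close> were outside \<open>R\<close>, clearing
  denominators in its relation would make some power of \<open>u\<close> a multiple of
  \<open>p\<close>; but all powers of \<open>u\<close> are 1 modulo \<open>p\<close>.\<close>

lemma one_minus_multiple_unit:
  assumes "b \<in> R"
  shows "1 - p * b \<noteq> 0" "inverse (1 - p * b) \<in> R"
proof -
  define u where "u = 1 - p * b"
  have u: "u \<in> R" "u \<noteq> 0"
    using assms not_p_multiple_1[OF assms] by (auto simp: u_def intro: diff_mem one_mem mult_mem p_mem)
  have pow: "\<exists>s\<in>R. u ^ n = 1 - p * s" for n
  proof (induction n)
    case (Suc n)
    then obtain s where "s \<in> R" "u ^ n = 1 - p * s" by blast
    then have "u ^ Suc n = (1 - p * b) * (1 - p * s)"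
      by (simp add: u_def)
    also have "\<dots> = 1 - p * (b + s - p * (b * s))"
      by (simp add: algebra_simps)
    finally have "u ^ Suc n = 1 - p * (b + s - p * (b * s))" .
    moreover have "b + s - p * (b * s) \<in> R"
      using assms \<open>s \<in> R\<close> by (intro diff_mem add_mem mult_mem p_mem)
    ultimately show ?case by blast
  qed (auto intro!: bexI[of _ 0] zero_mem)
  have "inverse u \<in> R"
  proof (rule ccontr)
    assume "inverse u \<notin> R"
    then obtain a n where a: "\<And>i. a i \<in> R" "p * (\<Sum>i\<le>n. a i * inverse u ^ i) = 1"
      using ex_p_relation unfolding p_relation_def by blast
    have "u ^ n = u ^ n * (p * (\<Sum>i\<le>n. a i * inverse u ^ i))"
      by (simp add: a(2))
    also have "\<dots> = p * (\<Sum>i\<le>n. a i * u ^ (n - i))"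
      using u(2) by (auto simp: sum_distrib_left sum_distrib_right power_diff field_simps intro!: sum.cong)
    finally have un: "u ^ n = p * (\<Sum>i\<le>n. a i * u ^ (n - i))" .
    obtain s where s: "s \<in> R" "u ^ n = 1 - p * s"
      using pow by blast
    have "p * ((\<Sum>i\<le>n. a i * u ^ (n - i)) + s) = 1"
      using un s(2) by (simp add: algebra_simps)
    moreover have "(\<Sum>i\<le>n. a i * u ^ (n - i)) + s \<in> R"
      using a(1) u(1) s(1) by (intro add_mem sum_mem mult_mem power_mem)
    ultimately show False
      using not_p_multiple_1 by blast
  qed
  with u(2) show "1 - p * b \<noteq> 0" "inverse (1 - p * b) \<in> R"
    by (auto simp: u_def)
qed

text \<open>Eliminates the leading power of \<open>x\<close> by means of the relation for \<open>inverse x\<close>.\<close>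

lemma p_relation_descent:
  assumes "p_relation x (Suc n)" "p_relation (inverse x) m" "m \<le> Suc n" "x \<noteq> 0"
  shows "p_relation x n"
proof -
  obtain a where a: "\<And>i. a i \<in> R" "p * (\<Sum>i\<le>Suc n. a i * x ^ i) = 1"
    using assms(1) by (auto simp: p_relation_def)
  obtain b where b: "\<And>i. b i \<in> R" "p * (\<Sum>i\<le>m. b i * inverse x ^ i) = 1"
    using assms(2) by (auto simp: p_relation_def)
  define v where "v = inverse (1 - p * b 0)"
  have v: "v \<in> R" "v * (1 - p * b 0) = 1"
    using one_minus_multiple_unit[OF b(1)[of 0]] by (auto simp: v_def)
  \<comment> \<open>Coefficients after solving the relation of \<open>inverse x\<close> for 1 by
    means of the unit \<open>1 - p * b 0\<close>, padded with zeros up to index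
    \<open>Suc n\<close>.\<close>
  define b' where "b' j = (if j = 0 \<or> j > m then 0 else v * b j)" for j
  have b': "b' j \<in> R" for j
    by (auto simp: b'_def zero_mem intro: mult_mem v b)
  have "1 - p * b 0 = p * (\<Sum>j\<in>{..m}-{0}. b j * inverse x ^ j)"
    using b(2) by (simp add: sum.remove[of "{..m}" 0] algebra_simps)
  then have "1 = v * (p * (\<Sum>j\<in>{..m}-{0}. b j * inverse x ^ j))"
    using v(2) by simp
  also have "\<dots> = p * (\<Sum>j\<in>{..m}-{0}. b' j * inverse x ^ j)"
    unfolding sum_distrib_left by (auto simp: b'_def intro!: sum.cong)
  also have "(\<Sum>j\<in>{..m}-{0}. b' j * inverse x ^ j) = (\<Sum>j\<le>Suc n. b' j * inverse x ^ j)"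
    using assms(3) by (intro sum.mono_neutral_left) (auto simp: b'_def)
  finally have one: "1 = p * (\<Sum>j\<le>Suc n. b' j * inverse x ^ j)" .
  have "x ^ Suc n = x ^ Suc n * (p * (\<Sum>j\<le>Suc n. b' j * inverse x ^ j))"
    by (simp only: one[symmetric] mult_1_right)
  also have "\<dots> = p * (\<Sum>j\<le>Suc n. b' j * x ^ (Suc n - j))"
    using assms(4)
    by (auto simp: sum_distrib_left sum_distrib_right power_diff field_simps simp del: power_Suc sum.atMost_Suc
        intro!: sum.cong)
  also have "(\<Sum>j\<le>Suc n. b' j * x ^ (Suc n - j)) = (\<Sum>i\<le>Suc n. b' (Suc n - i) * x ^ i)"
    by (rule sum.reindex_bij_witness[of _ "\<lambda>i. Suc n - i" "\<lambda>i. Suc n - i"]) auto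
  \<comment> \<open>The leading power drops out of the right-hand side because
    \<open>b' 0 = 0\<close>.\<close>
  also have "\<dots> = (\<Sum>i\<le>n. b' (Suc n - i) * x ^ i)"
    by (simp add: b'_def)
  finally have x: "x ^ Suc n = p * (\<Sum>i\<le>n. b' (Suc n - i) * x ^ i)" .
  have "1 = p * ((\<Sum>i\<le>n. a i * x ^ i) + a (Suc n) * x ^ Suc n)"
    using a(2) by simp
  also have "\<dots> = p * (\<Sum>i\<le>n. (a i + a (Suc n) * (p * b' (Suc n - i))) * x ^ i)"
    unfolding x by (simp add: sum_distrib_left sum.distrib algebra_simps)
  finally have "p * (\<Sum>i\<le>n. (a i + a (Suc n) * (p * b' (Suc n - i))) * x ^ i) = 1" ..
  moreover have "a i + a (Suc n) * (p * b' (Suc n - i)) \<in> R" for i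
    by (intro add_mem mult_mem a b' p_mem)
  ultimately show ?thesis
    unfolding p_relation_def by (intro exI[of _ "\<lambda>i. a i + a (Suc n) * (p * b' (Suc n - i))"]) blast
qed

lemma not_p_relation_0: "\<not> p_relation x 0"
  using not_p_multiple_1 by (auto simp: p_relation_def)

text \<open>If neither were in \<open>R\<close>, take relations of least degree for both; the one of
  larger degree could be shortened with the help of the other.\<close>

theorem mem_or_inverse_mem: "x \<in> R \<or> inverse x \<in> R"
proof (rule ccontr)
  assume neg: "\<not> ?thesis"
  then have x: "x \<noteq> 0" using zero_mem by auto
  have "\<exists>n. p_relation x n" "\<exists>n. p_relation (inverse x) n"
    using neg ex_p_relation by auto
  then obtain n m where nm: "p_relation x n" "\<And>k. k < n \<Longrightarrow> \<not> p_relation x k"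
      "p_relation (inverse x) m" "\<And>k. k < m \<Longrightarrow> \<not> p_relation (inverse x) k"
    using exists_least_iff[of "p_relation x"] exists_least_iff[of "p_relation (inverse x)"] by auto
  obtain n' m' where "n = Suc n'" "m = Suc m'"
    using nm not_p_relation_0 by (metis not0_implies_Suc)
  then show False
    using p_relation_descent[of x n' m] p_relation_descent[of "inverse x" m' n] nm x
    by (cases "m \<le> n") auto
qed

end

lemma ex_maximal_subring:
  fixes p :: "'a :: field"
  assumes "subring R0" "p \<in> R0" "p \<noteq> 0" "inverse p \<notin> R0"
  shows "\<exists>R. maximal_subring R p"
proof -
  let ?A = "{R. subring R \<and> p \<in> R \<and> inverse p \<notin> R}"
  have "\<exists>M\<in>?A. \<forall>X\<in>?A. M \<subseteq> X \<longrightarrow> X = M"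
  proof (rule subset_Zorn_nonempty)
    show "?A \<noteq> {}" using assms by blast
  next
    fix C assume C: "C \<noteq> {}" "subset.chain ?A C"
    have sub: "subring X" "p \<in> X" "inverse p \<notin> X" if "X \<in> C" for X
      using C(2) that by (auto simp: subset.chain_def)
    have both: "\<exists>X\<in>C. x \<in> X \<and> y \<in> X" if "x \<in> \<Union>C" "y \<in> \<Union>C" for x y
      using C(2) that unfolding subset_chain_def by (metis UnionE subset_iff)
    have "subring (\<Union>C)"
    proof
      show "1 \<in> \<Union>C" using C(1) sub(1) subring.one_mem by blast
      fix x y assume "x \<in> \<Union>C" "y \<in> \<Union>C"
      then obtain X where "X \<in> C" "x \<in> X" "y \<in> X" using both by blast
      then show "x - y \<in> \<Union>C" "x * y \<in> \<Union>C"
        using sub(1) subring.diff_mem subring.mult_mem by blast+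
    qed
    then show "\<Union>C \<in> ?A" using C(1) sub by blast
  qed
  then obtain M where M: "subring M" "p \<in> M" "inverse p \<notin> M"
      "\<And>X. subring X \<Longrightarrow> p \<in> X \<Longrightarrow> inverse p \<notin> X \<Longrightarrow> M \<subseteq> X \<Longrightarrow> X = M"
    by blast
  interpret subring M by (rule M)
  have "maximal_subring M p"
    by unfold_locales (use M assms in blast)+
  then show ?thesis by blast
qed

locale padic_valuation_ring =
  fixes R :: "complex set" and p :: nat
  assumes prime_p: "prime p" and maximal_subring: "maximal_subring R (of_nat p)"
begin

sublocale maximal_subring R "of_nat p"
  by (rule maximal_subring)

text \<open>Otherwise \<open>inverse x\<close> is in \<open>R\<close>, and dividing the monic
  equation by the power of \<open>x\<close> one below the leading one writes \<open>x\<close> as an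
  integer polynomial in \<open>inverse x\<close>.\<close>

lemma integrally_closed:
  fixes f :: "int poly"
  assumes "monic f" "poly (of_int_poly f) x = 0"
  shows "x \<in> R"
proof (rule ccontr)
  assume x: "x \<notin> R"
  then have inv: "inverse x \<in> R" "x \<noteq> 0"
    using mem_or_inverse_mem[of x] zero_mem by auto
  define n where "n = degree f"
  have "n \<noteq> 0"
  proof
    assume "n = 0"
    then have "f = 1" using assms(1) by (metis monic_degree_0 n_def)
    then show False using assms(2) by simp
  qed
  then obtain m where m: "n = Suc m" by (cases n) auto
  have "0 = (\<Sum>i\<le>n. of_int (coeff f i) * x ^ i)"
    using assms(2) by (simp add: poly_altdef n_def)
  also have "\<dots> = (\<Sum>i\<le>m. of_int (coeff f i) * x ^ i) + x ^ n"
    using assms(1) by (simp add: m n_def[symmetric, unfolded m])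
  finally have "x ^ n = - (\<Sum>i\<le>m. of_int (coeff f i) * x ^ i)"
    by (simp add: add_eq_0_iff2)
  have "x = inverse x ^ m * x ^ n"
    using inv(2) by (simp add: m field_simps)
  also have "\<dots> = - (\<Sum>i\<le>m. of_int (coeff f i) * inverse x ^ (m - i))"
    unfolding \<open>x ^ n = _\<close> using inv(2)
    by (auto simp: sum_distrib_left power_diff field_simps intro!: sum.cong)
  also have "\<dots> \<in> R"
    by (intro uminus_mem sum_mem mult_mem of_int_mem power_mem inv)
  finally show False using x by simp
qed

lemma power_mem_imp_mem:
  assumes "x ^ n \<in> R" "n > 0"
  shows "x \<in> R"
proof (cases "inverse x \<in> R \<and> x \<noteq> 0")
  case True
  have "x = x ^ n * inverse x ^ (n - 1)"
    using True assms(2) by (cases n) (auto simp: field_simps)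
  also have "\<dots> \<in> R"
    using True by (intro mult_mem[OF assms(1)] power_mem) auto
  finally show ?thesis .
qed (use mem_or_inverse_mem zero_mem in auto)

section \<open>The real-valued norm of the valuation ring\<close>

text \<open>The norm may vanish on nonzero transcendental elements, so it is only a seminorm on \<open>R\<close>.\<close>

definition pow_dvd :: "nat \<Rightarrow> nat \<Rightarrow> complex \<Rightarrow> bool" where
  "pow_dvd a b x \<longleftrightarrow> x ^ b / of_nat p ^ a \<in> R"

text \<open>The valuation is taken to be the supremum of the rationals a/b such that
  \<open>p ^ a\<close> divides \<open>x ^ b\<close> in \<open>R\<close>. This gives a real-valued
  norm whatever the value group of \<open>R\<close> is.\<close>

definition pnorm :: "complex \<Rightarrow> real" where
  "pnorm x = Inf {real p powr - (real a / real b) | a b. b > 0 \<and> pow_dvd a b x}"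

lemma p_gt_1: "real p > 1" "p > 1" "p > 0"
  using prime_gt_1_nat[OF prime_p] by auto

lemma inverse_power_p_notin: "a > 0 \<Longrightarrow> inverse (of_nat p ^ a) \<notin> R"
  using power_mem_imp_mem[of "inverse (of_nat p)" a] inverse_p_notin by (auto simp: power_inverse)

lemma pow_dvd_mono:
  assumes "pow_dvd a b x" "c * b \<le> a * d" "b > 0"
  shows "pow_dvd c d x"
proof -
  have "(x ^ b / of_nat p ^ a) ^ d * of_nat p ^ (a * d - c * b) \<in> R"
    using assms(1) by (intro mult_mem power_mem of_nat_mem) (auto simp: pow_dvd_def)
  also have "(x ^ b / of_nat p ^ a) ^ d * of_nat p ^ (a * d - c * b) = (x ^ d / of_nat p ^ c) ^ b"
    using assms(2) p_nonzero
    by (simp add: power_diff power_divide mult.commute flip: power_mult)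
  finally show ?thesis
    unfolding pow_dvd_def using assms(3) by (rule power_mem_imp_mem)
qed

lemma pnorm_bdd: "bdd_below {real p powr - (real a / real b) | a b. b > 0 \<and> pow_dvd a b x}"
  by (rule bdd_belowI[of _ 0]) auto

lemma pow_dvd_0: "x \<in> R \<Longrightarrow> pow_dvd 0 b x"
  by (auto simp: pow_dvd_def power_mem)

lemma pnorm_nonempty:
  "x \<in> R \<Longrightarrow> {real p powr - (real a / real b) | a b. b > 0 \<and> pow_dvd a b x} \<noteq> {}"
  using pow_dvd_0 by blast

lemma powr_power_eq:
  assumes "b > 0"
  shows "(real p powr - (real a / real b)) ^ b = (1 / real p) ^ a"
proof -
  have "(real p powr - (real a / real b)) ^ b = real p powr (- (real a / real b) * real b)"
    using p_gt_1 by (simp add: powr_powr flip: powr_realpow)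
  also have "\<dots> = (1 / real p) ^ a"
    using p_gt_1 assms by (simp add: powr_minus powr_realpow power_one_over inverse_eq_divide)
  finally show ?thesis .
qed

lemma pnorm_nonneg: "x \<in> R \<Longrightarrow> 0 \<le> pnorm x"
  unfolding pnorm_def by (rule cInf_greatest[OF pnorm_nonempty]) auto

lemma pnorm_le: "pow_dvd a b x \<Longrightarrow> b > 0 \<Longrightarrow> pnorm x \<le> real p powr - (real a / real b)"
  unfolding pnorm_def by (intro cInf_lower pnorm_bdd) auto

lemma pnorm_le_1: "x \<in> R \<Longrightarrow> pnorm x \<le> 1"
  using pnorm_le[OF pow_dvd_0, of x 1] p_gt_1 by simp

text \<open>The infimum need not be attained; the strict inequality provides a fraction c/d above
  a/b that is.\<close>

lemma pow_dvd_if_pnorm_power_less: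
  assumes "x \<in> R" "pnorm x ^ b < (1 / real p) ^ a" "b > 0"
  shows "pow_dvd a b x"
proof -
  have "pnorm x < real p powr - (real a / real b)"
    using assms(2,3) powr_power_eq[OF assms(3), of a] pnorm_nonneg[OF assms(1)]
    by (metis power_less_imp_less_base powr_ge_zero)
  then obtain c d where cd: "d > 0" "pow_dvd c d x"
      "real p powr - (real c / real d) < real p powr - (real a / real b)"
    unfolding pnorm_def by (auto dest!: cInf_lessD[OF pnorm_nonempty[OF assms(1)]])
  then have "real a / real b < real c / real d"
    using p_gt_1 by simp
  then have "real (a * d) < real (c * b)"
    using cd(1) assms(3) by (simp add: field_simps)
  then have "a * d \<le> c * b"
    by linarith
  then show ?thesis
    using cd by (intro pow_dvd_mono[OF cd(2)]) auto
qed

lemma pow_dvd_mult: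
  assumes "pow_dvd a b x" "pow_dvd c d y"
  shows "pow_dvd (a * d + c * b) (b * d) (x * y)"
proof -
  have "(x ^ b / of_nat p ^ a) ^ d * (y ^ d / of_nat p ^ c) ^ b \<in> R"
    using assms by (intro mult_mem power_mem) (auto simp: pow_dvd_def)
  also have "(x ^ b / of_nat p ^ a) ^ d * (y ^ d / of_nat p ^ c) ^ b
      = (x * y) ^ (b * d) / of_nat p ^ (a * d + c * b)"
    by (simp add: power_divide power_mult_distrib power_add mult.commute flip: power_mult)
  finally show ?thesis
    by (simp add: pow_dvd_def)
qed

lemma le_Inf_mult:
  fixes s r :: real
  assumes "A \<noteq> {}" "0 \<le> s" "\<And>t. t \<in> A \<Longrightarrow> r \<le> s * t" "\<And>t. t \<in> A \<Longrightarrow> 0 \<le> t"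
  shows "r \<le> s * Inf A"
proof (cases "s = 0")
  case False
  then have "s > 0" using assms(2) by simp
  then have "r / s \<le> Inf A"
    using assms by (intro cInf_greatest) (auto simp: field_simps)
  then show ?thesis using \<open>s > 0\<close> by (simp add: field_simps)
qed (use assms in auto)

lemma pnorm_mult_le:
  assumes "x \<in> R" "y \<in> R"
  shows "pnorm (x * y) \<le> pnorm x * pnorm y"
proof -
  have *: "pnorm (x * y) \<le> real p powr - (real a / real b) * real p powr - (real c / real d)"
    if "b > 0" "d > 0" "pow_dvd a b x" "pow_dvd c d y" for a b c d
  proof -
    have "real (a * d + c * b) / real (b * d) = real a / real b + real c / real d"
      using that by (simp add: field_simps)
    then have "real p powr - (real a / real b) * real p powr - (real c / real d)
        = real p powr - (real (a * d + c * b) / real (b * d))"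
      by (simp flip: powr_add)
    then show ?thesis
      using pnorm_le[OF pow_dvd_mult[OF that(3,4)]] that by simp
  qed
  have **: "pnorm (x * y) \<le> real p powr - (real a / real b) * pnorm y"
    if "b > 0" "pow_dvd a b x" for a b
    unfolding pnorm_def[of y] using that * by (intro le_Inf_mult pnorm_nonempty assms) auto
  have "pnorm (x * y) \<le> pnorm y * pnorm x"
    unfolding pnorm_def[of x] using ** assms
    by (intro le_Inf_mult pnorm_nonempty pnorm_nonneg) (auto simp: mult.commute)
  then show ?thesis by (simp add: mult.commute)
qed

text \<open>Take the least \<open>a\<close> for which \<open>(1 / p) ^ a\<close> is below
  \<open>pnorm x ^ b\<close>; by minimality only a factor \<open>p\<close> is lost.\<close>

lemma ex_not_pow_dvd:
  assumes "x \<in> R" "pnorm x > 0" "b > 0"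
  obtains a where "\<not> pow_dvd a b x" "pnorm x ^ b / real p \<le> (1 / real p) ^ a"
proof -
  let ?P = "\<lambda>a. (1 / real p) ^ a < pnorm x ^ b"
  have "\<exists>a. ?P a"
    using p_gt_1 assms(2) by (intro real_arch_pow_inv) auto
  then obtain a where a: "?P a" "\<And>k. k < a \<Longrightarrow> \<not> ?P k"
    using exists_least_iff[of ?P] by auto
  have "pnorm x ^ b \<le> 1"
    using pnorm_le_1[OF assms(1)] assms(2) by (simp add: power_le_one)
  then have "a \<noteq> 0" using a(1) by (cases a) auto
  then obtain k where k: "a = Suc k" by (cases a) auto
  have "\<not> pow_dvd a b x"
  proof
    assume "pow_dvd a b x"
    then have "pnorm x ^ b \<le> (real p powr - (real a / real b)) ^ b"
      using assms by (intro power_mono pnorm_le) auto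
    then show False
      using a(1) powr_power_eq[OF assms(3)] by simp
  qed
  moreover have "pnorm x ^ b / real p \<le> (1 / real p) ^ a"
    using a(2)[of k] p_gt_1 by (auto simp: k not_less field_simps)
  ultimately show thesis using that by blast
qed

lemma pnorm_0: "pnorm 0 = 0"
proof (rule ccontr)
  assume "pnorm 0 \<noteq> 0"
  then have "pnorm 0 > 0" using pnorm_nonneg[OF zero_mem] by simp
  then obtain a where "\<not> pow_dvd a 1 0"
    using ex_not_pow_dvd[OF zero_mem, of 1] by auto
  then show False by (simp add: pow_dvd_def zero_mem)
qed

text \<open>If the norm of \<open>x * y\<close> were too small, a high power of \<open>x * y\<close>
  would be divisible by one more \<open>p\<close> than the powers of \<open>x\<close> and
  \<open>y\<close> allow. The quotients that fail to lie in \<open>R\<close> have their inverses in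
  \<open>R\<close>, and multiplying by these leaves 1/p in \<open>R\<close>.\<close>

theorem pnorm_mult:
  assumes "x \<in> R" "y \<in> R"
  shows "pnorm (x * y) = pnorm x * pnorm y"
proof (rule antisym[OF pnorm_mult_le[OF assms]], rule ccontr)
  define t where "t = pnorm x * pnorm y"
  have xy: "x * y \<in> R" using assms by (rule mult_mem)
  assume "\<not> pnorm x * pnorm y \<le> pnorm (x * y)"
  then have less: "pnorm (x * y) < t" by (simp add: t_def)
  then have pos: "pnorm x > 0" "pnorm y > 0" "t > 0"
    using pnorm_nonneg assms xy unfolding t_def
    by (metis less_eq_real_def mult_eq_0_iff not_less order.strict_trans1)+
  have nz: "x \<noteq> 0" "y \<noteq> 0" using pos pnorm_0 by auto
  \<comment> \<open>Of the three factors \<open>p\<close>, one is lost in choosing \<open>a\<close>,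
    one in choosing \<open>c\<close>, and one makes the contradiction.\<close>
  have "\<exists>n. (pnorm (x * y) / t) ^ n < (1 / real p) ^ 3"
    using less pos p_gt_1 by (intro real_arch_pow_inv) auto
  then obtain b where b: "(pnorm (x * y) / t) ^ b < (1 / real p) ^ 3" by blast
  have "b \<noteq> 0"
    using b power_le_one[of "1 / real p" 3] p_gt_1 by (intro notI) auto
  then have b0: "b > 0" by simp
  obtain a where a: "\<not> pow_dvd a b x" "pnorm x ^ b / real p \<le> (1 / real p) ^ a"
    using ex_not_pow_dvd[OF assms(1) pos(1) b0] by blast
  obtain c where c: "\<not> pow_dvd c b y" "pnorm y ^ b / real p \<le> (1 / real p) ^ c"
    using ex_not_pow_dvd[OF assms(2) pos(2) b0] by blast
  have "pnorm (x * y) ^ b < t ^ b * (1 / real p) ^ 3"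
    using b pos by (simp add: power_divide field_simps)
  also have "\<dots> = (pnorm x ^ b / real p) * (pnorm y ^ b / real p) * (1 / real p)"
    by (simp add: t_def power_mult_distrib power3_eq_cube)
  also have "\<dots> \<le> (1 / real p) ^ a * (1 / real p) ^ c * (1 / real p)"
    using a(2) c(2) pos p_gt_1 by (intro mult_mono) auto
  also have "\<dots> = (1 / real p) ^ (a + c + 1)"
    by (simp add: power_add)
  finally have "pow_dvd (a + c + 1) b (x * y)"
    by (intro pow_dvd_if_pnorm_power_less xy b0)
  then have "(x * y) ^ b / of_nat p ^ (a + c + 1) * (inverse (x ^ b / of_nat p ^ a)
      * inverse (y ^ b / of_nat p ^ c)) \<in> R"
    using a(1) c(1) mem_or_inverse_mem unfolding pow_dvd_def by (intro mult_mem) blast+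
  also have "(x * y) ^ b / of_nat p ^ (a + c + 1) * (inverse (x ^ b / of_nat p ^ a)
      * inverse (y ^ b / of_nat p ^ c)) = inverse (of_nat p)"
    using nz p_gt_1 by (simp add: power_mult_distrib power_add field_simps)
  finally show False
    using inverse_p_notin by simp
qed

text \<open>Of two nonzero elements one divides the other in a valuation ring; factoring it out
  leaves 1 plus an element of \<open>R\<close>, whose norm is at most 1.\<close>

theorem pnorm_add_le:
  assumes "x \<in> R" "y \<in> R"
  shows "pnorm (x + y) \<le> max (pnorm x) (pnorm y)"
proof -
  have *: "pnorm (x + y) \<le> pnorm x" if "x \<in> R" "y / x \<in> R" "x \<noteq> 0" for x y
  proof -
    have "pnorm (x * (1 + y / x)) = pnorm x * pnorm (1 + y / x)"
      using that by (intro pnorm_mult add_mem one_mem)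
    also have "\<dots> \<le> pnorm x * 1"
      using that by (intro mult_left_mono pnorm_le_1 pnorm_nonneg add_mem one_mem)
    finally show ?thesis using that(3) by (simp add: distrib_left)
  qed
  show ?thesis
  proof (cases "x = 0 \<or> y = 0")
    case False
    then have "y / x \<in> R \<or> x / y \<in> R"
      using mem_or_inverse_mem[of "y / x"] by simp
    then show ?thesis
      using *[of x y] *[of y x] assms False by (auto simp: add.commute)
  qed auto
qed

lemma pnorm_1: "pnorm 1 = 1"
proof -
  have "a = 0" if "pow_dvd a b 1" for a b
    using that inverse_power_p_notin[of a] by (auto simp: pow_dvd_def inverse_eq_divide)
  then have "1 \<le> real p powr - (real a / real b)" if "pow_dvd a b 1" for a b
    using that p_gt_1 by fastforce
  then have "1 \<le> pnorm 1"
    unfolding pnorm_def using p_gt_1 by (intro cInf_greatest pnorm_nonempty one_mem) auto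
  then show ?thesis using pnorm_le_1[OF one_mem] by simp
qed

lemma pnorm_p: "pnorm (of_nat p) = 1 / real p"
proof (rule antisym)
  have "pow_dvd 1 1 (of_nat p)"
    using p_nonzero by (simp add: pow_dvd_def one_mem)
  from pnorm_le[OF this] show "pnorm (of_nat p) \<le> 1 / real p"
    using p_gt_1 by (simp add: powr_minus inverse_eq_divide)
  have "a \<le> b" if "pow_dvd a b (of_nat p)" for a b
  proof (rule ccontr)
    assume "\<not> a \<le> b"
    then have "inverse (of_nat p ^ (a - b)) = (of_nat p ^ b / of_nat p ^ a :: complex)"
      using p_nonzero by (simp add: power_diff field_simps)
    then show False
      using that inverse_power_p_notin[of "a - b"] \<open>\<not> a \<le> b\<close> by (simp add: pow_dvd_def)
  qed
  then have "real p powr - 1 \<le> real p powr - (real a / real b)"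
    if "pow_dvd a b (of_nat p)" "b > 0" for a b
    using that p_gt_1 by (intro powr_mono) (auto simp: field_simps)
  then have "real p powr - 1 \<le> pnorm (of_nat p)"
    unfolding pnorm_def by (intro cInf_greatest pnorm_nonempty p_mem) auto
  then show "1 / real p \<le> pnorm (of_nat p)"
    using p_gt_1 by (simp add: powr_minus inverse_eq_divide)
qed

lemma pnorm_uminus: "x \<in> R \<Longrightarrow> pnorm (- x) = pnorm x"
proof -
  assume x: "x \<in> R"
  have "pnorm (- 1) * pnorm (- 1) = 1"
    using pnorm_mult[of "- 1" "- 1"] pnorm_1 uminus_mem[OF one_mem] by simp
  then have "pnorm (- 1) = 1"
    using pnorm_nonneg[OF uminus_mem[OF one_mem]] by (simp add: square_eq_1_iff)
  then show ?thesis
    using pnorm_mult[of "- 1" x] x uminus_mem[OF one_mem] by simp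
qed

lemma pnorm_power: "x \<in> R \<Longrightarrow> pnorm (x ^ n) = pnorm x ^ n"
  by (induction n) (auto simp: pnorm_1 pnorm_mult power_mem)

text \<open>For \<open>m\<close> prime to \<open>p\<close>, write 1 as a combination of
  \<open>p\<close> and \<open>m\<close>. The multiple of \<open>p\<close> has norm below 1, so by
  the ultrametric inequality \<open>m\<close> has norm 1.\<close>

lemma pnorm_of_int:
  assumes "n \<noteq> 0"
  shows "pnorm (of_int n) = (1 / real p) ^ multiplicity (int p) n"
proof -
  have "\<not> is_unit (int p)" using p_gt_1 by simp
  then obtain m where m: "n = int p ^ multiplicity (int p) n * m" "\<not> int p dvd m"
    using multiplicity_decompose'[of n "int p"] assms by metis
  have "coprime (int p) m"
    using m(2) prime_p by (simp add: prime_imp_coprime)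
  then obtain u w where "u * int p + w * m = 1"
    using bezout_int by (metis coprime_imp_gcd_eq_1)
  then have "of_int (u * int p + w * m) = (1 :: complex)" by simp
  then have eq: "of_int u * of_nat p + of_int w * of_int m = (1 :: complex)" by simp
  have "1 \<le> max (pnorm (of_int u * of_nat p)) (pnorm (of_int w * of_int m))"
    unfolding pnorm_1[symmetric] eq[symmetric]
    by (intro pnorm_add_le mult_mem of_int_mem p_mem)
  moreover have "pnorm (of_int u * of_nat p) < 1"
  proof -
    have "pnorm (of_int u * of_nat p) = pnorm (of_int u) * (1 / real p)"
      by (simp add: pnorm_mult of_int_mem p_mem pnorm_p)
    also have "\<dots> \<le> 1 * (1 / real p)"
      by (intro mult_right_mono pnorm_le_1 of_int_mem) auto
    also have "\<dots> < 1" using p_gt_1 by simp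
    finally show ?thesis .
  qed
  ultimately have "1 \<le> pnorm (of_int w * of_int m)" by linarith
  also have "\<dots> = pnorm (of_int w) * pnorm (of_int m)"
    by (intro pnorm_mult of_int_mem)
  also have "\<dots> \<le> 1 * pnorm (of_int m)"
    by (intro mult_right_mono pnorm_le_1 pnorm_nonneg of_int_mem)
  finally have "pnorm (of_int m) = 1"
    using pnorm_le_1[OF of_int_mem, of m] by simp
  moreover have "pnorm (of_int n) = pnorm (of_nat p ^ multiplicity (int p) n * of_int m)"
    by (subst m(1)) simp
  ultimately show ?thesis
    by (simp add: pnorm_mult pnorm_power pnorm_p power_mem of_int_mem p_mem)
qed

lemma pnorm_of_int_le:
  assumes "int p ^ k dvd n"
  shows "pnorm (of_int n) \<le> (1 / real p) ^ k"
proof -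
  from assms obtain m where "n = int p ^ k * m" by auto
  then have "pnorm (of_int n) = (1 / real p) ^ k * pnorm (of_int m)"
    by (simp add: pnorm_mult pnorm_power pnorm_p power_mem of_int_mem p_mem)
  also have "\<dots> \<le> (1 / real p) ^ k * 1"
    by (intro mult_left_mono pnorm_le_1 of_int_mem) auto
  finally show ?thesis by simp
qed

end

lemma ex_padic_valuation_ring:
  assumes "prime p"
  shows "\<exists>R. padic_valuation_ring R p"
proof -
  have "subring (\<int> :: complex set)"
    by unfold_locales auto
  moreover have "inverse (of_nat p) \<notin> (\<int> :: complex set)"
  proof
    assume "inverse (of_nat p) \<in> (\<int> :: complex set)"
    then obtain n where "inverse (of_nat p) = (of_int n :: complex)"
      by (rule Ints_cases)
    then have "of_int (int p * n) = (1 :: complex)"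
      using assms by (simp add: field_simps prime_gt_0_nat)
    then have "int p * n = 1" by (simp only: of_int_eq_1_iff)
    then show False
      using prime_gt_1_nat[OF assms] by (auto simp: zmult_eq_1_iff)
  qed
  moreover have "of_nat p \<in> (\<int> :: complex set)"
    by simp
  ultimately have "\<exists>R. maximal_subring R (of_nat p :: complex)"
    using assms by (intro ex_maximal_subring) auto
  then show ?thesis
    using assms by (auto simp: padic_valuation_ring_def)
qed

section \<open>Truncated valuations and Gauss' lemma\<close>

context padic_valuation_ring
begin

text \<open>\<open>min (v x) k\<close> for the additive valuation \<open>v\<close>; the truncation avoids infinite values.\<close>

definition tval :: "nat \<Rightarrow> complex \<Rightarrow> real" where
  "tval k x = - log p (max (pnorm x) ((1 / p) ^ k))"

lemma powr_tval: "real p powr - tval k x = max (pnorm x) ((1 / p) ^ k)"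
proof -
  have "max (pnorm x) ((1 / p) ^ k) > 0"
    using p_gt_1 by (simp add: less_max_iff_disj)
  then show ?thesis
    using p_gt_1 by (simp add: tval_def)
qed

lemma powr_minus_nat: "real p powr - real k = (1 / p) ^ k"
  using p_gt_1 by (simp add: powr_minus powr_realpow power_one_over inverse_eq_divide)

lemma powr_le_iff: "real p powr - a \<le> real p powr - b \<longleftrightarrow> b \<le> a"
  using p_gt_1 by simp

lemma tval_le: "tval k x \<le> k"
proof -
  have "real p powr - real k \<le> real p powr - tval k x"
    by (simp add: powr_tval powr_minus_nat)
  then show ?thesis by (simp only: powr_le_iff)
qed

lemma tval_nonneg:
  assumes "x \<in> R"
  shows "0 \<le> tval k x"
proof -
  have "real p powr - tval k x \<le> real p powr - 0"
    using pnorm_le_1[OF assms] p_gt_1 by (simp add: powr_tval power_le_one)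
  then show ?thesis by (simp only: powr_le_iff)
qed

lemma powr_min: "real p powr - min a b = max (real p powr - a) (real p powr - b)"
  using p_gt_1 by (auto simp: min_def max_def)

lemma powr_inject: "real p powr - a = real p powr - b \<Longrightarrow> a = b"
  by (metis order.antisym order.refl powr_le_iff)

lemma tval_min:
  assumes "j \<le> k"
  shows "tval j x = min (tval k x) (real j)"
proof (rule powr_inject)
  have "(1 / real p) ^ k \<le> (1 / real p) ^ j"
    using assms p_gt_1 by (intro power_decreasing) auto
  then show "real p powr - tval j x = real p powr - min (tval k x) (real j)"
    by (simp add: powr_min powr_tval powr_minus_nat)
qed

lemma tval_add:
  assumes "x \<in> R" "y \<in> R"
  shows "min (tval k x) (tval k y) \<le> tval k (x + y)"
proof -
  have "real p powr - tval k (x + y) \<le> real p powr - min (tval k x) (tval k y)"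
    using pnorm_add_le[OF assms] by (auto simp: powr_min powr_tval)
  then show ?thesis by (simp only: powr_le_iff)
qed

lemma tval_uminus: "x \<in> R \<Longrightarrow> tval k (- x) = tval k x"
  by (simp add: tval_def pnorm_uminus)

lemma tval_diff:
  assumes "x \<in> R" "y \<in> R"
  shows "min (tval k x) (tval k y) \<le> tval k (x - y)"
  using tval_add[OF assms(1) uminus_mem[OF assms(2)], of k] assms(2) by (simp add: tval_uminus)

lemma tval_multiple:
  assumes "int p ^ k dvd n"
  shows "tval k (of_int n) = k"
proof (rule powr_inject)
  show "real p powr - tval k (of_int n) = real p powr - real k"
    using pnorm_of_int_le[OF assms] by (simp add: powr_tval powr_minus_nat)
qed

lemma tval_cong:
  assumes "[m = n] (mod int p ^ k)" "x \<in> R"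
  shows "tval k (of_int m - x) = tval k (of_int n - x)"
proof -
  have *: "tval k (of_int n - x) \<le> tval k (of_int m - x)" if "[m = n] (mod int p ^ k)" for m n
  proof -
    have "min (tval k (of_int n - x)) (tval k (of_int (m - n))) \<le> tval k (of_int n - x + of_int (m - n))"
      using assms(2) by (intro tval_add diff_mem of_int_mem)
    then show ?thesis
      using that tval_le[of k "of_int n - x"] tval_multiple[of k "m - n"]
      by (simp add: cong_iff_dvd_diff)
  qed
  show ?thesis
    using *[of m n] *[of n m] assms(1) by (simp add: cong_sym_eq)
qed

text \<open>Level \<open>0\<close> has weight \<open>1\<close> because every integral root lies in the root of the tree.\<close>

definition step :: "nat \<Rightarrow> complex \<Rightarrow> real" where
  "step k x = (if k = 0 then 1 else tval k x - tval (k - 1) x)"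

lemma step_0 [simp]: "step 0 x = 1"
  by (simp add: step_def)

lemma step_Suc: "step (Suc k) x = tval (Suc k) x - min (tval (Suc k) x) (real k)"
  using tval_min[of k "Suc k" x] by (simp add: step_def)

lemma step_bounds: "0 \<le> step k x" "step k x \<le> 1"
  using tval_le[of k x] by (cases k; simp add: step_Suc min_def)+

lemma step_cong:
  assumes "[m = n] (mod int p ^ k)" "x \<in> R"
  shows "step k (of_int m - x) = step k (of_int n - x)"
  using tval_cong[OF assms] by (cases k) (auto simp: step_Suc)

lemma sum_step: "(\<Sum>j<d. step (Suc j) x) = tval d x - tval 0 x"
  by (induction d) (auto simp: step_def)

lemma tval_0: "x \<in> R \<Longrightarrow> tval 0 x = 0"
  using tval_le[of 0 x] tval_nonneg[of x 0] by simp

text \<open>The steps of one element are 1 up to its valuation, then possibly one fraction, then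
  0.\<close>

lemma step_Suc_nonzero_imp_1:
  assumes "step (Suc k) x \<noteq> 0"
  shows "step k x = 1"
proof (cases k)
  case (Suc l)
  have "tval k x = k"
    using assms tval_min[of k "Suc k" x] by (auto simp: step_Suc min_def split: if_splits)
  then show ?thesis by (simp add: Suc step_Suc)
qed simp

text \<open>A nonzero step at level \<open>Suc k\<close> means norm below
  \<open>(1 / p) ^ k\<close>, but representatives of two different children differ by an element of
  norm exactly \<open>(1 / p) ^ k\<close>.\<close>

lemma step_child_unique:
  assumes "x \<in> R" "c < p" "c' < p"
    and "step (Suc k) (of_int (n + int c * int p ^ k) - x) \<noteq> 0"
    and "step (Suc k) (of_int (n + int c' * int p ^ k) - x) \<noteq> 0"
  shows "c = c'"
proof (rule ccontr)
  assume "c \<noteq> c'"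
  define z where "z = (int c - int c') * int p ^ k"
  let ?x = "of_int (n + int c * int p ^ k) - x" and ?y = "of_int (n + int c' * int p ^ k) - x"
  have "min (tval (Suc k) ?x) (tval (Suc k) ?y) \<le> tval (Suc k) (?x - ?y)"
    using assms(1) by (intro tval_diff diff_mem of_int_mem)
  also have "?x - ?y = of_int z"
    by (simp add: z_def algebra_simps)
  finally have "real k < tval (Suc k) (of_int z)"
    using assms(4,5) by (auto simp: step_Suc min_def split: if_splits)
  then have "real p powr - tval (Suc k) (of_int z) < real p powr - real k"
    using p_gt_1 by simp
  then have less: "pnorm (of_int z) < (1 / real p) ^ k"
    by (simp add: powr_tval powr_minus_nat)
  have "\<not> [c = c'] (mod p)"
    using assms(2,3) \<open>c \<noteq> c'\<close> cong_less_modulus_unique_nat by blast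
  then have "\<not> int p dvd int c - int c'"
    by (simp flip: cong_iff_dvd_diff cong_int_iff)
  then have "multiplicity (int p) (int c - int c') = 0"
    by (rule not_dvd_imp_multiplicity_0)
  then have "pnorm (of_int (int c - int c')) = 1"
    using \<open>c \<noteq> c'\<close> pnorm_of_int[of "int c - int c'"] by simp
  then have "pnorm (of_int z) = (1 / real p) ^ k"
    unfolding z_def
    by (simp add: pnorm_mult pnorm_power pnorm_p of_nat_mem diff_mem power_mem)
  with less show False by simp
qed

lemma sum_le_if_unique_support:
  fixes f :: "'b \<Rightarrow> real"
  assumes "finite A" "0 \<le> B" "\<And>x. x \<in> A \<Longrightarrow> f x \<le> B"
    and "\<And>x y. x \<in> A \<Longrightarrow> y \<in> A \<Longrightarrow> f x \<noteq> 0 \<Longrightarrow> f y \<noteq> 0 \<Longrightarrow> x = y"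
  shows "sum f A \<le> B"
proof (cases "\<exists>x\<in>A. f x \<noteq> 0")
  case True
  then obtain x where x: "x \<in> A" "f x \<noteq> 0" by blast
  then have "sum f A = sum f {x}"
    using assms(1,4) by (intro sum.mono_neutral_right) auto
  then show ?thesis using assms(3) x by simp
qed (use assms(2) in simp)

lemma sum_step_children:
  assumes "x \<in> R"
  shows "(\<Sum>c<p. step (Suc k) (of_int (n + int c * int p ^ k) - x)) \<le> step k (of_int n - x)"
proof (rule sum_le_if_unique_support)
  fix c assume "c \<in> {..<p}"
  have "step (Suc k) (of_int (n + int c * int p ^ k) - x) \<le> step k (of_int (n + int c * int p ^ k) - x)"
    using step_Suc_nonzero_imp_1[of k] step_bounds
    by (cases "step (Suc k) (of_int (n + int c * int p ^ k) - x) = 0") auto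
  also have "\<dots> = step k (of_int n - x)"
    using assms by (intro step_cong) (auto simp: cong_def)
  finally show "step (Suc k) (of_int (n + int c * int p ^ k) - x) \<le> step k (of_int n - x)" .
qed (use assms step_child_unique step_bounds in auto)

lemma step_mult_le:
  assumes "x \<in> R" "y \<in> R"
  shows "step (Suc k) x * step (Suc k) y \<le> step (Suc k) (x - y)"
proof -
  have "step (Suc k) x * step (Suc k) y \<le> min (step (Suc k) x) (step (Suc k) y)"
    using mult_left_le[OF step_bounds(2,1), of "Suc k" y "Suc k" x]
      mult_left_le[OF step_bounds(2,1), of "Suc k" x "Suc k" y] by (simp add: mult.commute)
  also have "\<dots> \<le> step (Suc k) (x - y)"
    using tval_diff[OF assms, of "Suc k"] by (auto simp: step_Suc min_def split: if_splits)
  finally show ?thesis .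
qed

lemma tree_sum_step_zero:
  assumes "x \<in> R" "step k (of_int n - x) = 0"
  shows "tree_sum p (\<lambda>k n. step k (of_int n - x) * h k n) d k n = 0"
  using assms(2)
proof (induction d arbitrary: k n)
  case (Suc d)
  have "(\<Sum>c<p. step (Suc k) (of_int (n + int c * int p ^ k) - x)) \<le> 0"
    using sum_step_children[OF assms(1), of k n] Suc.prems by simp
  then have "step (Suc k) (of_int (n + int c * int p ^ k) - x) = 0" if "c < p" for c
    using that sum_nonneg_eq_0_iff[of "{..<p}" "\<lambda>c. step (Suc k) (of_int (n + int c * int p ^ k) - x)"]
      step_bounds(1) by (simp add: order.antisym[OF _ sum_nonneg])
  then show ?case
    using Suc by simp
qed simp

text \<open>Below a class only one child can meet \<open>x\<close>, and there the product of the
  steps is at most the step of \<open>x - y\<close>. Down the tree these steps telescope.\<close>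

lemma tree_sum_step_le:
  assumes "x \<in> R" "y \<in> R"
  shows "(\<Sum>c<p. tree_sum p (\<lambda>k n. step k (of_int n - x) * step k (of_int n - y)) d (Suc k)
      (n + int c * int p ^ k)) \<le> tval (k + d) (x - y) - tval k (x - y)"
proof (induction d arbitrary: k n)
  case (Suc d)
  let ?T = "tree_sum p (\<lambda>k n. step k (of_int n - x) * step k (of_int n - y))"
  let ?m = "\<lambda>c. n + int c * int p ^ k"
  show ?case
  proof (rule sum_le_if_unique_support)
    show "0 \<le> tval (k + Suc d) (x - y) - tval k (x - y)"
      using tval_min[of k "k + Suc d" "x - y"] by simp
  next
    fix c
    have "?T (Suc d) (Suc k) (?m c)
        \<le> step (Suc k) (of_int (?m c) - x) * step (Suc k) (of_int (?m c) - y)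
          + (tval (Suc k + d) (x - y) - tval (Suc k) (x - y))"
      using Suc.IH[of "Suc k" "?m c"] by simp
    also have "step (Suc k) (of_int (?m c) - x) * step (Suc k) (of_int (?m c) - y)
        \<le> step (Suc k) (y - x)"
    proof -
      have "of_int (?m c) - x \<in> R" "of_int (?m c) - y \<in> R"
        by (intro diff_mem of_int_mem assms)+
      from step_mult_le[OF this, of k] show ?thesis by simp
    qed
    also have "step (Suc k) (y - x) = tval (Suc k) (x - y) - tval k (x - y)"
      using assms tval_uminus[of "x - y"] by (simp add: step_def diff_mem)
    finally show "?T (Suc d) (Suc k) (?m c) \<le> tval (k + Suc d) (x - y) - tval k (x - y)"
      by simp
  next
    fix c c' assume *: "c \<in> {..<p}" "c' \<in> {..<p}"
      "?T (Suc d) (Suc k) (?m c) \<noteq> 0" "?T (Suc d) (Suc k) (?m c') \<noteq> 0"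
    then have "step (Suc k) (of_int (?m c) - x) \<noteq> 0" "step (Suc k) (of_int (?m c') - x) \<noteq> 0"
      using tree_sum_step_zero[OF assms(1), where h = "\<lambda>k n. step k (of_int n - y)"] by blast+
    then show "c = c'"
      using step_child_unique[OF assms(1)] * by blast
  qed simp
qed simp

section \<open>Gauss' lemma for products of linear factors\<close>

definition gauss_norm :: "complex poly \<Rightarrow> real \<Rightarrow> bool" where
  "gauss_norm q M \<longleftrightarrow> (\<forall>i. coeff q i \<in> R \<and> pnorm (coeff q i) \<le> M) \<and> (\<exists>i. pnorm (coeff q i) = M)"

lemma pnorm_add_eq:
  assumes "x \<in> R" "y \<in> R" "pnorm y < pnorm x"
  shows "pnorm (x + y) = pnorm x"
proof -
  have "pnorm x \<le> max (pnorm (x + y)) (pnorm (- y))"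
    using pnorm_add_le[of "x + y" "- y"] assms by (simp add: add_mem uminus_mem)
  then show ?thesis
    using pnorm_add_le[OF assms(1,2)] assms(2,3) by (auto simp: pnorm_uminus)
qed

text \<open>If \<open>u\<close> dominates, look at the first coefficient of \<open>q\<close> of norm
  \<open>M\<close>; if \<open>w\<close> is strictly larger, at the last one. The other contribution
  to the resulting coefficient is strictly smaller there, so nothing cancels.\<close>

lemma gauss_norm_linear_mult:
  assumes "gauss_norm q M" "u \<in> R" "w \<in> R"
  shows "gauss_norm ([:u, w:] * q) (max (pnorm u) (pnorm w) * M)"
proof -
  define c where "c = max (pnorm u) (pnorm w)"
  have q: "coeff q i \<in> R" "pnorm (coeff q i) \<le> M" for i
    using assms(1) by (auto simp: gauss_norm_def)
  have M: "0 \<le> M"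
    using pnorm_nonneg[OF q(1)] q(2) by (rule order.trans)
  have c0: "0 \<le> c"
    using assms by (simp add: c_def pnorm_nonneg le_max_iff_disj)
  have coeff: "coeff ([:u, w:] * q) i = u * coeff q i + (if i = 0 then 0 else w * coeff q (i - 1))" for i
    by (cases i) auto
  have mem: "coeff ([:u, w:] * q) i \<in> R" for i
    unfolding coeff using assms q by (auto intro: add_mem mult_mem zero_mem)
  have uM: "pnorm (u * coeff q i) \<le> c * M" and wM: "pnorm (w * coeff q i) \<le> c * M" for i
    using assms q c0 by (auto simp: pnorm_mult c_def pnorm_nonneg intro!: mult_mono)
  have le: "pnorm (coeff ([:u, w:] * q) i) \<le> c * M" for i
  proof -
    have "pnorm (coeff ([:u, w:] * q) i)
        \<le> max (pnorm (u * coeff q i)) (pnorm (if i = 0 then 0 else w * coeff q (i - 1)))"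
      unfolding coeff using assms q by (intro pnorm_add_le) (auto intro: mult_mem zero_mem)
    then show ?thesis
      using uM[of i] wM[of "i - 1"] c0 M by (auto simp: pnorm_0 split: if_splits)
  qed
  have "\<exists>i. pnorm (coeff ([:u, w:] * q) i) = c * M"
  proof (cases "c * M = 0")
    case True
    then show ?thesis
      by (metis le mem pnorm_nonneg order.antisym)
  next
    case False
    then have pos: "c > 0" "M > 0" using c0 M by auto
    let ?I = "{i. pnorm (coeff q i) = M}"
    have ne: "?I \<noteq> {}" using assms(1) by (auto simp: gauss_norm_def)
    have "?I \<subseteq> {..degree q}"
      using pos(2) by (auto simp: pnorm_0 intro: le_degree)
    then have fin: "finite ?I" by (rule finite_subset) auto
    have lt: "pnorm (coeff q i) < M" if "i \<notin> ?I" for i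
      using that q(2)[of i] by auto
    show ?thesis
    proof (cases "pnorm w \<le> pnorm u")
      case True
      then have c: "c = pnorm u" by (simp add: c_def)
      define j where "j = Min ?I"
      have j: "pnorm (coeff q j) = M" using Min_in[OF fin ne] by (simp add: j_def)
      have "pnorm (coeff q (j - 1)) < M" if "j \<noteq> 0"
        using that Min_le[OF fin, of "j - 1"] by (intro lt) (auto simp: j_def[symmetric])
      then have "pnorm w * pnorm (coeff q (j - 1)) < pnorm u * M" if "j \<noteq> 0"
        using that True pos c q
        by (intro le_less_trans[OF mult_right_mono mult_strict_left_mono]) (auto simp: pnorm_nonneg)
      then have "pnorm (coeff ([:u, w:] * q) j) = pnorm (u * coeff q j)"
        unfolding coeff using assms q pos c j
        by (intro pnorm_add_eq) (auto simp: pnorm_mult pnorm_0 intro: mult_mem zero_mem)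
      then show ?thesis
        using assms q j by (auto simp: pnorm_mult c)
    next
      case False
      then have c: "c = pnorm w" by (simp add: c_def)
      define j where "j = Max ?I"
      have j: "pnorm (coeff q j) = M" using Max_in[OF fin ne] by (simp add: j_def)
      have "pnorm (coeff q (Suc j)) < M"
        using Max_ge[OF fin, of "Suc j"] by (intro lt) (auto simp: j_def[symmetric])
      then have "pnorm u * pnorm (coeff q (Suc j)) < pnorm w * M"
        using False pos c q
        by (intro le_less_trans[OF mult_right_mono mult_strict_left_mono]) (auto simp: pnorm_nonneg)
      then have "pnorm (w * coeff q j + u * coeff q (Suc j)) = pnorm (w * coeff q j)"
        using assms q j by (intro pnorm_add_eq) (auto simp: pnorm_mult intro: mult_mem)
      then have "pnorm (coeff ([:u, w:] * q) (Suc j)) = c * M"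
        using assms q j by (simp add: pnorm_mult c add.commute)
      then show ?thesis by blast
    qed
  qed
  then show ?thesis
    using mem le by (simp add: gauss_norm_def c_def)
qed

lemma gauss_norm_prod_linear:
  assumes "finite I" "\<And>i. i \<in> I \<Longrightarrow> u i \<in> R" "w \<in> R"
  shows "gauss_norm (\<Prod>i\<in>I. [:u i, w:]) (\<Prod>i\<in>I. max (pnorm (u i)) (pnorm w))"
  using assms(1,2)
proof (induction I rule: finite_induct)
  case empty
  have "pnorm (coeff 1 i) \<le> 1" "coeff 1 i \<in> R" for i
    by (auto simp: pnorm_1 pnorm_0 zero_mem one_mem)
  then show ?case
    by (auto simp: gauss_norm_def pnorm_1 intro: exI[of _ 0])
next
  case (insert i I)
  then show ?case
    using gauss_norm_linear_mult[of "\<Prod>i\<in>I. [:u i, w:]"] assms(3) by simp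
qed

end

section \<open>Resultants and roots\<close>

text \<open>The rule would rewrite \<open>[:- x, 1:]\<close> to \<open>pCons (- x) 1\<close>.\<close>

declare pCons_one [simp del]

text \<open>One step of Euclid's algorithm, read off the subresultant recursion at index 0. A
  constant remainder is the boundary case, where the index equals the degree of the
  remainder.\<close>

lemma resultant_mod:
  fixes f g :: "'a :: field poly"
  assumes "degree g \<le> degree f" "degree g > 0" "f mod g \<noteq> 0"
  shows "resultant f g = (-1) ^ (degree f * degree g) *
    lead_coeff g ^ (degree f - degree (f mod g)) * resultant g (f mod g)"
proof -
  define h where "h = f mod g"
  have eq: "f + (- (f div g)) * g = h"
    using div_mult_mod_eq[of f g] by (simp add: h_def algebra_simps)
  have lt: "degree h < degree g"
    using assms(2,3) degree_mod_less'[of g f] by (cases "g = 0") (auto simp: h_def)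
  show ?thesis
  proof (cases "degree h = 0")
    case False
    have "subresultant 0 f g = smult ((-1) ^ ((degree f - 0) * (degree g - 0)) *
        lead_coeff g ^ (degree f - degree h)) (subresultant 0 g h)"
      using False lt by (intro BT_lemma_1_12[OF eq assms(1)]) auto
    then show ?thesis
      by (simp add: subresultant_resultant h_def)
  next
    case True
    then obtain c where c: "h = [:c:]"
      by (rule degree_eq_zeroE)
    have "subresultant (degree h) f g = smult ((-1) ^ ((degree f - degree h) * (degree g - degree h)) *
        lead_coeff g ^ (degree f - degree h) * lead_coeff h ^ (degree g - degree h - 1)) h"
      using lt by (intro BT_lemma_1_13[OF eq assms(1)]) auto
    then show ?thesis
      using assms(2) by (simp add: subresultant_resultant c h_def[symmetric] power_eq_if[of c "degree g"] mult_ac)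
  qed
qed

lemma resultant_mod_0:
  fixes f g :: "'a :: field poly"
  assumes "degree g \<le> degree f" "degree g > 0" "f mod g = 0"
  shows "resultant f g = 0"
  using subresultant_product[of f "f div g" g 0] assms
  by (simp add: subresultant_resultant flip: dvd_eq_mod_eq_0)

lemma poly_prod_mset_linear: "poly (\<Prod>x\<in>#A. [:- x, 1:]) y = (\<Prod>x\<in>#A. y - (x :: 'a :: comm_ring_1))"
  by (induction A) (auto simp: algebra_simps)

lemma prod_mset_diff_swap:
  "(\<Prod>y\<in>#B. \<Prod>z\<in>#C. y - (z :: 'a :: comm_ring_1))
    = (-1) ^ (size B * size C) * (\<Prod>z\<in>#C. \<Prod>y\<in>#B. z - y)"
proof (induction B)
  case (add y B)
  have "(\<Prod>z\<in>#C. y - z) = (-1) ^ size C * (\<Prod>z\<in>#C. z - y)"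
    by (induction C) (auto simp: algebra_simps)
  then show ?case
    using add by (simp add: prod_mset.distrib power_add mult_ac)
qed simp

lemma prod_mset_const_mult:
  "(\<Prod>x\<in>#A. c * f x) = (c :: 'a :: comm_monoid_mult) ^ size A * (\<Prod>x\<in>#A. f x)"
  by (induction A) (auto simp: mult_ac)

lemma degree_prod_mset_linear: "degree (\<Prod>x\<in>#A. [:- x, 1 :: 'a :: idom:]) = size A"
proof (induction A)
  case (add x A)
  have "(\<Prod>x\<in>#A. [:- x, 1 :: 'a:]) \<noteq> 0" by (auto simp: prod_mset_zero_iff)
  then show ?case using add by (simp add: degree_mult_eq del: mult_pCons_left)
qed simp

lemma monic_prod_mset_linear: "lead_coeff (\<Prod>x\<in>#A. [:- x, 1 :: 'a :: idom:]) = 1"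
  by (induction A) (auto simp: lead_coeff_mult simp del: mult_pCons_left)

text \<open>Up to sign both sides are \<open>b ^ size C * c ^ size B\<close> times the product of
  all differences of roots.\<close>

lemma prod_poly_roots_swap:
  fixes b c :: "'a :: idom"
  assumes "g = smult b (\<Prod>y\<in>#B. [:- y, 1:])" "h = smult c (\<Prod>z\<in>#C. [:- z, 1:])"
  shows "b ^ size C * (\<Prod>y\<in>#B. poly h y)
    = (-1) ^ (size B * size C) * c ^ size B * (\<Prod>z\<in>#C. poly g z)"
  using prod_mset_diff_swap[of C B]
  by (simp add: assms poly_prod_mset_linear prod_mset_const_mult mult_ac)

lemma resultant_eq_prod_roots_right:
  fixes f g :: "'a :: alg_closed_field poly"
  assumes "g = smult b (\<Prod>y\<in>#B. [:- y, 1:])" "b \<noteq> 0" "degree g \<le> degree f" "f \<noteq> 0"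
  shows "resultant f g = (-1) ^ (degree f * degree g) * b ^ degree f * (\<Prod>y\<in>#B. poly f y)"
  using assms
proof (induction "degree g" arbitrary: f g b B rule: less_induct)
  case less
  note g = less.prems(1)
  have sizeB: "degree g = size B" and lc: "lead_coeff g = b"
    using less.prems(1,2) monic_prod_mset_linear[of B] by (simp_all add: degree_prod_mset_linear)
  define h where "h = f mod g"
  have poly_h: "poly h y = poly f y" if "y \<in># B" for y
  proof -
    have "poly g y = 0"
      using that by (auto simp: g poly_prod_mset_linear)
    then show ?thesis
      by (simp add: h_def poly_mod)
  qed
  show ?case
  proof (cases "degree g = 0")
    case True
    then have "B = {#}" using sizeB by simp
    then show ?thesis by (simp add: g)
  next
    case pos: False
    show ?thesis
    proof (cases "h = 0")
      case True
      then have "resultant f g = 0"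
        using pos less.prems by (intro resultant_mod_0) (auto simp: h_def)
      moreover obtain y where "y \<in># B"
        using pos sizeB by (metis multiset_nonemptyE size_empty)
      then have "(\<Prod>y\<in>#B. poly f y) = 0"
        using poly_h[of y] True by (auto simp: prod_mset_zero_iff)
      ultimately show ?thesis by simp
    next
      case False
      have lt: "degree h < degree g"
        using pos False degree_mod_less'[of g f] by (cases "g = 0") (auto simp: h_def)
      have "degree h \<le> degree f" using lt less.prems(3) by simp
      \<comment> \<open>With the remainder \<open>h\<close> factored, the induction hypothesis
        applies to \<open>g\<close> and \<open>h\<close>; its product over the roots of
        \<open>h\<close> is then turned into one over the roots of \<open>g\<close>, where
        \<open>h\<close> and \<open>f\<close> agree.\<close>
      obtain C where C: "size C = degree h" "h = smult (lead_coeff h) (\<Prod>z\<in>#C. [:- z, 1:])"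
        using alg_closed_imp_factorization[OF False] by blast
      define c where "c = lead_coeff h"
      have "resultant g h = (-1) ^ (degree g * degree h) * c ^ degree g * (\<Prod>z\<in>#C. poly g z)"
        using C False lt pos by (intro less.hyps) (auto simp: c_def)
      also have "\<dots> = b ^ size C * (\<Prod>y\<in>#B. poly h y)"
        using prod_poly_roots_swap[OF g C(2)] by (simp add: c_def sizeB C(1))
      also have "(\<Prod>y\<in>#B. poly h y) = (\<Prod>y\<in>#B. poly f y)"
        by (intro arg_cong[of _ _ prod_mset] image_mset_cong poly_h)
      finally have "resultant g h = b ^ degree h * (\<Prod>y\<in>#B. poly f y)"
        by (simp add: C(1))
      moreover have "resultant f g
          = (-1) ^ (degree f * degree g) * b ^ (degree f - degree h) * resultant g h"
        using resultant_mod[OF less.prems(3)] pos False lc by (simp add: h_def)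
      moreover have "b ^ (degree f - degree h) * b ^ degree h = b ^ degree f"
        using \<open>degree h \<le> degree f\<close> by (simp flip: power_add)
      ultimately show ?thesis by (simp add: mult_ac)
    qed
  qed
qed

theorem resultant_eq_prod_roots:
  fixes f g :: "'a :: alg_closed_field poly"
  assumes "f = (\<Prod>x\<in>#A. [:- x, 1:])" "g = (\<Prod>y\<in>#B. [:- y, 1:])"
  shows "resultant f g = (\<Prod>x\<in>#A. \<Prod>y\<in>#B. x - y)"
proof -
  have deg: "degree f = size A" "degree g = size B"
    by (simp_all add: assms degree_prod_mset_linear)
  have nz: "f \<noteq> 0" "g \<noteq> 0"
    by (auto simp: assms prod_mset_zero_iff)
  have polys: "poly f z = (\<Prod>x\<in>#A. z - x)" "poly g z = (\<Prod>y\<in>#B. z - y)" for z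
    by (simp_all add: assms poly_prod_mset_linear)
  have sgn: "(-1) ^ n * ((-1) ^ n * z) = (z :: 'a)" for n z
    by (simp flip: mult.assoc power_add)
  show ?thesis
  proof (cases "degree g \<le> degree f")
    case True
    have "resultant f g = (-1) ^ (degree f * degree g) * 1 ^ degree f * (\<Prod>y\<in>#B. poly f y)"
      by (rule resultant_eq_prod_roots_right) (use True nz in \<open>simp_all flip: assms(2)\<close>)
    then have "resultant f g = (-1) ^ (size A * size B) * (\<Prod>y\<in>#B. \<Prod>x\<in>#A. y - x)"
      by (simp add: deg polys)
    then show ?thesis
      by (simp add: prod_mset_diff_swap[of A B] mult.commute[of "size B"] sgn)
  next
    case False
    have "resultant g f = (-1) ^ (degree g * degree f) * 1 ^ degree g * (\<Prod>x\<in>#A. poly g x)"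
      by (rule resultant_eq_prod_roots_right) (use False nz in \<open>simp_all flip: assms(1)\<close>)
    then have "resultant g f = (-1) ^ (size A * size B) * (\<Prod>x\<in>#A. \<Prod>y\<in>#B. x - y)"
      by (simp add: deg polys mult.commute)
    then show ?thesis
      using resultant_swap[of f g] by (simp add: deg sgn)
  qed
qed

section \<open>The lower bound for the resultant\<close>

lemma of_nat_tree_sum:
  "of_nat (tree_sum p F d k n) = tree_sum p (\<lambda>k n. of_nat (F k n) :: 'a :: comm_semiring_1) d k n"
  by (induction d arbitrary: k n) auto

lemma tree_sum_sum:
  "tree_sum p (\<lambda>k n. \<Sum>i\<in>I. F i k n) d k n = (\<Sum>i\<in>I. tree_sum p (F i) d k n)"
proof (induction d arbitrary: k n)
  case (Suc d)
  then show ?case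
    by (simp add: sum.distrib sum.swap[of _ I])
qed simp

lemma le_vp_iff:
  assumes "prime p"
  shows "enat s \<le> vp p x \<longleftrightarrow> int p ^ s dvd x"
proof -
  have "\<not> is_unit (int p)" using prime_gt_1_nat[OF assms] by simp
  then show ?thesis
    by (auto simp: vp_def power_dvd_iff_le_multiplicity)
qed

text \<open>In additive terms, the sum of truncated valuations is at least the truncated sum. Hence
  a tree of finite depth still sees the required valuation of a value of \<open>f\<close>.\<close>

lemma prod_max_le:
  fixes a :: "'a \<Rightarrow> real"
  assumes "finite I" "\<And>i. i \<in> I \<Longrightarrow> 0 \<le> a i \<and> a i \<le> 1" "0 \<le> q" "q \<le> 1"
  shows "(\<Prod>i\<in>I. max (a i) q) \<le> max (\<Prod>i\<in>I. a i) q"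
  using assms(1,2)
proof (induction I rule: finite_induct)
  case (insert i I)
  define Y where "Y = (\<Prod>i\<in>I. a i)"
  have Y: "0 \<le> Y" "Y \<le> 1"
    using insert by (auto simp: Y_def intro: prod_nonneg prod_le_1)
  have i: "0 \<le> a i" "a i \<le> 1" using insert by auto
  have "max (a i) q * (\<Prod>i\<in>I. max (a i) q) \<le> max (a i) q * max Y q"
    using insert assms(3) by (intro mult_left_mono) (auto simp: Y_def le_max_iff_disj)
  also have "\<dots> \<le> max (a i * Y) q"
  proof (cases "q \<le> a i")
    case True
    have "a i * max Y q \<le> max (a i * Y) q"
      using i assms(3) mult_right_mono[of "a i" 1 q] by (auto simp: max_def)
    then show ?thesis using True by simp
  next
    case False
    have "q * max Y q \<le> q * 1"
      using Y assms(3,4) by (intro mult_left_mono) auto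
    then show ?thesis using False by simp
  qed
  finally show ?case
    using insert by (simp add: Y_def)
qed simp

context padic_valuation_ring
begin

lemma prod_powr_tval:
  "finite I \<Longrightarrow> (\<Prod>i\<in>I. max (pnorm (x i)) ((1 / p) ^ k)) = real p powr - (\<Sum>i\<in>I. tval k (x i))"
proof (induction I rule: finite_induct)
  case (insert i I)
  have "real p powr - (\<Sum>i\<in>insert i I. tval k (x i))
      = real p powr - tval k (x i) * real p powr - (\<Sum>i\<in>I. tval k (x i))"
    using insert by (simp flip: powr_add)
  then show ?case
    using insert by (simp add: powr_tval)
qed (use p_gt_1 in simp)

lemma pnorm_prod:
  "finite I \<Longrightarrow> (\<And>i. i \<in> I \<Longrightarrow> x i \<in> R) \<Longrightarrow>
    (\<Prod>i\<in>I. x i) \<in> R \<and> pnorm (\<Prod>i\<in>I. x i) = (\<Prod>i\<in>I. pnorm (x i))"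
  by (induction I rule: finite_induct) (auto simp: pnorm_1 one_mem mult_mem pnorm_mult)

text \<open>For the roots of a monic integer polynomial the sum is already a natural number, so the
  rounding only changes the type.\<close>

definition root_weight :: "(nat \<Rightarrow> complex) \<Rightarrow> nat \<Rightarrow> nat \<Rightarrow> int \<Rightarrow> nat" where
  "root_weight \<alpha> m k n = nat \<lfloor>\<Sum>i<m. step k (of_int n - \<alpha> i)\<rfloor>"

end

locale split_monic_poly = padic_valuation_ring +
  fixes f :: "int poly" and \<alpha> :: "nat \<Rightarrow> complex" and m :: nat
  assumes split: "of_int_poly f = (\<Prod>i<m. [:- \<alpha> i, 1:])"
    and root_mem: "i < m \<Longrightarrow> \<alpha> i \<in> R"
begin

lemma poly_eq: "of_int (poly f n) = (\<Prod>i<m. of_int n - \<alpha> i)"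
proof -
  have "of_int (poly f n) = poly (of_int_poly f) (of_int n :: complex)" by simp
  then show ?thesis by (simp add: split poly_prod)
qed

text \<open>By Gauss' lemma the sum is the \<open>p\<close>-adic valuation of the content of \<open>f (n + p ^ k * X)\<close>.\<close>

lemma sum_tval_integral: "\<exists>N. (\<Sum>i<m. tval k (of_int n - \<alpha> i)) = real N"
proof -
  define F where "F = pcompose f [:n, int p ^ k:]"
  have "of_int_poly [:n, int p ^ k:] = [:of_int n :: complex, of_nat p ^ k:]"
    by (rule poly_eqI) (simp add: coeff_map_poly coeff_pCons split: nat.split)
  then have "of_int_poly F = pcompose (of_int_poly f) [:of_int n :: complex, of_nat p ^ k:]"
    by (simp add: F_def of_int_hom.map_poly_pcompose)
  also have "\<dots> = (\<Prod>i<m. [:of_int n - \<alpha> i, of_nat p ^ k:])"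
    by (simp add: split pcompose_prod pcompose_pCons)
  finally have "gauss_norm (of_int_poly F)
      (\<Prod>i<m. max (pnorm (of_int n - \<alpha> i)) (pnorm (of_nat p ^ k)))"
    using gauss_norm_prod_linear[of "{..<m}" "\<lambda>i. of_int n - \<alpha> i" "of_nat p ^ k"] root_mem
    by (simp add: diff_mem of_int_mem power_mem of_nat_mem)
  then obtain i where "pnorm (of_int (coeff F i)) = (\<Prod>i<m. max (pnorm (of_int n - \<alpha> i)) ((1 / p) ^ k))"
    by (auto simp: gauss_norm_def pnorm_power of_nat_mem pnorm_p)
  then have eq: "pnorm (of_int (coeff F i)) = real p powr - (\<Sum>i<m. tval k (of_int n - \<alpha> i))"
    by (simp add: prod_powr_tval)
  \<comment> \<open>The norm is a positive power of \<open>p\<close>, so this integer coefficient is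
    nonzero and the exponent is its multiplicity.\<close>
  then have "coeff F i \<noteq> 0"
    using p_gt_1 by (auto simp: pnorm_0)
  from pnorm_of_int[OF this] eq show ?thesis
    using powr_inject by (metis powr_minus_nat)
qed

lemma real_root_weight: "real (root_weight \<alpha> m k n) = (\<Sum>i<m. step k (of_int n - \<alpha> i))"
proof -
  have nonneg: "0 \<le> (\<Sum>i<m. step k (of_int n - \<alpha> i))"
    by (intro sum_nonneg step_bounds)
  have "\<exists>z :: int. (\<Sum>i<m. step k (of_int n - \<alpha> i)) = of_int z"
  proof (cases k)
    case 0
    then show ?thesis by (auto intro: exI[of _ "int m"])
  next
    case (Suc l)
    obtain M N where "(\<Sum>i<m. tval k (of_int n - \<alpha> i)) = real M"
        "(\<Sum>i<m. tval l (of_int n - \<alpha> i)) = real N"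
      using sum_tval_integral by metis
    then have "(\<Sum>i<m. step k (of_int n - \<alpha> i)) = of_int (int M - int N)"
      by (simp add: Suc step_def sum_subtractf)
    then show ?thesis by blast
  qed
  then show ?thesis
    using nonneg by (auto simp: root_weight_def)
qed

lemma tree_weight_root_weight: "tree_weight p (root_weight \<alpha> m)"
  unfolding tree_weight_def
proof (intro conjI allI impI)
  fix k n n' assume "[n' = n] (mod int p ^ k)"
  then show "root_weight \<alpha> m k n' = root_weight \<alpha> m k n"
    unfolding root_weight_def using step_cong root_mem by auto
next
  fix k n
  have "real (\<Sum>c<p. root_weight \<alpha> m (Suc k) (n + int c * int p ^ k))
      = (\<Sum>i<m. \<Sum>c<p. step (Suc k) (of_int (n + int c * int p ^ k) - \<alpha> i))"
    unfolding of_nat_sum real_root_weight by (rule sum.swap)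
  also have "\<dots> \<le> (\<Sum>i<m. step k (of_int n - \<alpha> i))"
    by (intro sum_mono sum_step_children root_mem) auto
  also have "\<dots> = real (root_weight \<alpha> m k n)"
    by (rule real_root_weight[symmetric])
  finally show "(\<Sum>c<p. root_weight \<alpha> m (Suc k) (n + int c * int p ^ k)) \<le> root_weight \<alpha> m k n"
    by (simp only: of_nat_le_iff)
qed

text \<open>The weights on levels 1 to \<open>d\<close> telescope to the sum of the valuations
  truncated at \<open>d\<close>, and \<open>s \<le> d\<close> keeps the truncation from cutting into
  \<open>s\<close>.\<close>

lemma le_sum_root_weight:
  assumes "int p ^ s dvd poly f n" "s \<le> d"
  shows "s \<le> (\<Sum>j<d. root_weight \<alpha> m (Suc 0 + j) n)"
proof -
  have mem: "of_int n - \<alpha> i \<in> R" if "i < m" for i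
    using that by (intro diff_mem of_int_mem root_mem)
  have "real p powr - (\<Sum>i<m. tval d (of_int n - \<alpha> i))
      = (\<Prod>i<m. max (pnorm (of_int n - \<alpha> i)) ((1 / p) ^ d))"
    by (simp add: prod_powr_tval)
  also have "\<dots> \<le> max (\<Prod>i<m. pnorm (of_int n - \<alpha> i)) ((1 / p) ^ d)"
    using p_gt_1 mem by (intro prod_max_le) (auto simp: pnorm_nonneg pnorm_le_1 power_le_one)
  also have "(\<Prod>i<m. pnorm (of_int n - \<alpha> i)) = pnorm (of_int (poly f n))"
    using pnorm_prod[of "{..<m}" "\<lambda>i. of_int n - \<alpha> i"] mem by (simp add: poly_eq)
  also have "max (pnorm (of_int (poly f n))) ((1 / p) ^ d) \<le> (1 / p) ^ s"
    using pnorm_of_int_le[OF assms(1)] assms(2) p_gt_1 by (auto intro: power_decreasing)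
  finally have "real s \<le> (\<Sum>i<m. tval d (of_int n - \<alpha> i))"
    by (simp only: powr_minus_nat[symmetric] powr_le_iff)
  also have "\<dots> = (\<Sum>i<m. \<Sum>j<d. step (Suc j) (of_int n - \<alpha> i))"
    using mem by (simp add: sum_step tval_0)
  also have "\<dots> = real (\<Sum>j<d. root_weight \<alpha> m (Suc 0 + j) n)"
    unfolding of_nat_sum real_root_weight by (subst sum.swap) simp
  finally show ?thesis by (simp only: of_nat_le_iff)
qed

end

context padic_valuation_ring
begin

text \<open>Links the multiset of roots, in which the resultant is expressed, with the roots listed
  by index, over which weights are summed; multiplicities are kept.\<close>

lemma ex_split_monic_poly:
  assumes "monic (f :: int poly)"
  shows "\<exists>\<alpha> A. split_monic_poly R p f \<alpha> (size A) \<and>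
    A = image_mset \<alpha> (mset_set {..<size A})"
proof -
  have "lead_coeff (of_int_poly f :: complex poly) = 1" "of_int_poly f \<noteq> (0 :: complex poly)"
    using assms by auto
  then obtain A where A: "of_int_poly f = (\<Prod>x\<in>#A. [:- x, 1 :: complex:])"
    using alg_closed_imp_factorization[of "of_int_poly f :: complex poly"] by auto
  obtain xs where xs: "mset xs = A" using ex_mset by blast
  have "A = mset (map ((!) xs) [0..<length xs])"
    by (simp only: map_nth xs)
  then have eq: "A = image_mset ((!) xs) (mset_set {..<size A})"
    using xs by (simp only: mset_map mset_upt lessThan_atLeast0 flip: size_mset)
  have "split_monic_poly R p f ((!) xs) (size A)"
  proof
    show "of_int_poly f = (\<Prod>i<size A. [:- xs ! i, 1:])"
      unfolding A by (subst eq) (simp add: prod_unfold_prod_mset image_mset.compositionality o_def)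
    fix i assume "i < size A"
    then have "xs ! i \<in># A" using xs by auto
    then have "poly (of_int_poly f) (xs ! i) = 0"
      by (auto simp: A poly_prod_mset_linear)
    then show "xs ! i \<in> R"
      using assms by (rule integrally_closed[rotated])
  qed
  with eq show ?thesis by blast
qed

text \<open>An arbitrary common exponent \<open>t\<close> at a point \<open>n\<close> takes the
  place of the maximum \<open>S\<close>, so that finiteness of \<open>S\<close> comes out as a
  consequence.\<close>

theorem pairing_le_multiplicity_resultant:
  fixes f g :: "int poly"
  assumes "monic f" "monic g" "resultant f g \<noteq> 0"
    and s1: "\<And>n. int p ^ s1 dvd poly f n" and s2: "\<And>n. int p ^ s2 dvd poly g n"
    and t: "int p ^ t dvd poly f n" "int p ^ t dvd poly g n"
  shows "t + p * pairing p s1 s2 \<le> multiplicity (int p) (resultant f g) + max s1 s2"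
proof -
  obtain \<alpha> A where A: "split_monic_poly R p f \<alpha> (size A)" "A = image_mset \<alpha> (mset_set {..<size A})"
    using ex_split_monic_poly[OF assms(1)] by blast
  obtain \<beta> B where B: "split_monic_poly R p g \<beta> (size B)" "B = image_mset \<beta> (mset_set {..<size B})"
    using ex_split_monic_poly[OF assms(2)] by blast
  define l m where "l = size A" and "m = size B"
  interpret f: split_monic_poly R p f \<alpha> l using A(1) by (simp add: l_def)
  interpret g: split_monic_poly R p g \<beta> m using B(1) by (simp add: m_def)
  define \<phi> \<psi> where "\<phi> = root_weight \<alpha> l" and "\<psi> = root_weight \<beta> m"
  \<comment> \<open>Deep enough that truncation affects none of the three exponents.\<close>
  define d where "d = max t (max s1 s2)"
  define T where "T c = tree_sum p (\<lambda>k n. \<phi> k n * \<psi> k n) d (Suc 0) (0 + int c * int p ^ 0)" for c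
  have p2: "2 \<le> p" using p_gt_1 by simp
  have wt: "tree_weight p \<phi>" "tree_weight p \<psi>"
    unfolding \<phi>_def \<psi>_def by (rule f.tree_weight_root_weight g.tree_weight_root_weight)+
  have path: "s1 \<le> (\<Sum>j<d. \<phi> (Suc 0 + j) n')" "s2 \<le> (\<Sum>j<d. \<psi> (Suc 0 + j) n')" for n'
    unfolding \<phi>_def \<psi>_def d_def
    by (intro f.le_sum_root_weight g.le_sum_root_weight s1 s2; simp)+
  have path_n: "t \<le> (\<Sum>j<d. \<phi> (Suc 0 + j) n)" "t \<le> (\<Sum>j<d. \<psi> (Suc 0 + j) n)"
    unfolding \<phi>_def \<psi>_def d_def
    by (intro f.le_sum_root_weight g.le_sum_root_weight t; simp)+
  obtain c where c: "c < p" "[n = 0 + int c * int p ^ 0] (mod int p ^ Suc 0)"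
    using ex_child[OF p2, of n 0 0] by auto
  have "card {..<p} * pairing p s1 s2 + (t - max s1 s2) \<le> sum T {..<p}"
  proof (rule sum_ge_with_excess)
    show "pairing p s1 s2 \<le> T x" for x
      unfolding T_def
      by (rule add_leD1[OF tree_sum_ge[OF p2 wt path(1) path(2) cong_refl]])
    have "pairing p s1 s2 + min ((\<Sum>j<d. \<phi> (Suc 0 + j) n) - s1) ((\<Sum>j<d. \<psi> (Suc 0 + j) n) - s2) \<le> T c"
      unfolding T_def by (rule tree_sum_ge[OF p2 wt path(1) path(2) c(2)])
    moreover have "t - max s1 s2 \<le> min ((\<Sum>j<d. \<phi> (Suc 0 + j) n) - s1) ((\<Sum>j<d. \<psi> (Suc 0 + j) n) - s2)"
      using path_n by linarith
    ultimately show "pairing p s1 s2 + (t - max s1 s2) \<le> T c" by linarith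
  qed (use c in auto)
  then have lower: "p * pairing p s1 s2 + (t - max s1 s2) \<le> sum T {..<p}" by simp
  define S where "S = (\<Sum>(i, j)\<in>{..<l} \<times> {..<m}. tval d (\<alpha> i - \<beta> j))"
  have "real (T c) = (\<Sum>i<l. \<Sum>j<m. tree_sum p (\<lambda>k n. step k (of_int n - \<alpha> i) * step k (of_int n - \<beta> j))
      d (Suc 0) (0 + int c * int p ^ 0))" for c
    unfolding T_def of_nat_tree_sum of_nat_mult \<phi>_def \<psi>_def f.real_root_weight g.real_root_weight
    unfolding sum_product tree_sum_sum ..
  then have "real (sum T {..<p}) = (\<Sum>c<p. \<Sum>i<l. \<Sum>j<m.
      tree_sum p (\<lambda>k n. step k (of_int n - \<alpha> i) * step k (of_int n - \<beta> j))
      d (Suc 0) (0 + int c * int p ^ 0))"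
    by simp
  also have "\<dots> = (\<Sum>i<l. \<Sum>j<m. \<Sum>c<p.
      tree_sum p (\<lambda>k n. step k (of_int n - \<alpha> i) * step k (of_int n - \<beta> j))
      d (Suc 0) (0 + int c * int p ^ 0))"
    by (subst sum.swap, intro sum.cong refl sum.swap)
  also have "\<dots> \<le> (\<Sum>i<l. \<Sum>j<m. tval (0 + d) (\<alpha> i - \<beta> j) - tval 0 (\<alpha> i - \<beta> j))"
    by (intro sum_mono tree_sum_step_le f.root_mem g.root_mem) auto
  also have "\<dots> = S"
    unfolding S_def using f.root_mem g.root_mem
    by (simp add: tval_0 diff_mem sum.cartesian_product)
  finally have upper: "real (sum T {..<p}) \<le> S" .
  have "of_int (resultant f g) = resultant (of_int_poly f) (of_int_poly g :: complex poly)"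
    by (simp add: of_int_hom.resultant_hom)
  also have "\<dots> = (\<Prod>x\<in>#A. \<Prod>y\<in>#B. x - y)"
    by (rule resultant_eq_prod_roots; subst A(2) B(2);
        simp add: f.split g.split prod_unfold_prod_mset image_mset.compositionality o_def l_def m_def)
  also have "\<dots> = (\<Prod>i<l. \<Prod>j<m. \<alpha> i - \<beta> j)"
    by (subst A(2), subst B(2))
      (simp add: prod_unfold_prod_mset image_mset.compositionality o_def l_def m_def)
  also have "\<dots> = (\<Prod>(i, j)\<in>{..<l} \<times> {..<m}. \<alpha> i - \<beta> j)"
    by (rule prod.cartesian_product)
  finally have "pnorm (of_int (resultant f g)) = pnorm (\<Prod>(i, j)\<in>{..<l} \<times> {..<m}. \<alpha> i - \<beta> j)"
    by simp
  also have "\<dots> = (\<Prod>x\<in>{..<l} \<times> {..<m}. pnorm (case x of (i, j) \<Rightarrow> \<alpha> i - \<beta> j))"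
    using f.root_mem g.root_mem by (intro pnorm_prod[THEN conjunct2]) (auto intro: diff_mem)
  \<comment> \<open>Truncation can only enlarge the norm of a factor, so \<open>S\<close> is at most
    the valuation of the resultant.\<close>
  also have "\<dots> \<le> (\<Prod>x\<in>{..<l} \<times> {..<m}. max (pnorm (case x of (i, j) \<Rightarrow> \<alpha> i - \<beta> j)) ((1 / p) ^ d))"
    using f.root_mem g.root_mem by (intro prod_mono) (auto intro!: pnorm_nonneg diff_mem)
  also have "\<dots> = real p powr - S"
    unfolding S_def by (subst prod_powr_tval) (auto intro!: sum.cong arg_cong[of _ _ uminus] arg_cong2[of _ _ _ _ "(powr)"])
  finally have "S \<le> real (multiplicity (int p) (resultant f g))"
    using pnorm_of_int[OF assms(3)] by (simp only: powr_minus_nat[symmetric] powr_le_iff)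
  with upper have "sum T {..<p} \<le> multiplicity (int p) (resultant f g)"
    by linarith
  with lower show ?thesis by linarith
qed

end

lemma pairing_eq_sum_min_resolution:
  assumes "2 \<le> p"
  shows "(\<Sum>i\<in>{i. p ^ i * min_resolution p a i * min_resolution p b i \<noteq> 0}.
      p ^ i * min_resolution p a i * min_resolution p b i) = pairing p a b"
  unfolding pairing_def min_resolution_eq_greedy[OF assms]
  by (intro sum.mono_neutral_left) (auto intro: ccontr simp: greedy_eq_0 not_less)

theorem mainTheorem3:
  fixes p s1 s2 :: nat and f g :: "int poly"
  assumes "prime p"
    and "monic f" and "monic g"
    and "resultant f g \<noteq> 0"
    and "\<And>n. vp p (poly f n) \<ge> enat s1"
    and "\<And>n. vp p (poly g n) \<ge> enat s2"
  shows "(SUP n. min (vp p (poly f n)) (vp p (poly g n))) \<noteq> \<infinity> \<and>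
    int (the_enat (vp p (resultant f g))) \<ge>
      int (the_enat (SUP n. min (vp p (poly f n)) (vp p (poly g n)))) - int (max s1 s2)
      + int p * int (\<Sum>i\<in>{i. p ^ i * min_resolution p s1 i * min_resolution p s2 i \<noteq> 0}.
            p ^ i * min_resolution p s1 i * min_resolution p s2 i)"
proof -
  obtain R where "padic_valuation_ring R p"
    using ex_padic_valuation_ring[OF assms(1)] by blast
  then interpret padic_valuation_ring R p .
  let ?v = "multiplicity (int p) (resultant f g)"
  let ?S = "SUP n. min (vp p (poly f n)) (vp p (poly g n))"
  have bound: "t + p * pairing p s1 s2 \<le> ?v + max s1 s2"
    if "enat t \<le> min (vp p (poly f n)) (vp p (poly g n))" for t n
    using that assms by (intro pairing_le_multiplicity_resultant[of f g s1 s2 t n])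
      (auto simp: le_vp_iff[OF assms(1), symmetric])
  define M where "M = ?v + max s1 s2 - p * pairing p s1 s2"
  \<comment> \<open>The case \<open>t = 0\<close> shows that the subtraction in \<open>M\<close> is
    exact; thus \<open>M\<close> bounds every admissible exponent, and the supremum is
    finite.\<close>
  have M: "p * pairing p s1 s2 \<le> ?v + max s1 s2"
    using bound[of 0] by (simp add: zero_enat_def[symmetric])
  have "?S \<le> enat M"
  proof (rule SUP_least, rule ccontr)
    fix n assume "\<not> min (vp p (poly f n)) (vp p (poly g n)) \<le> enat M"
    then have "enat (Suc M) \<le> min (vp p (poly f n)) (vp p (poly g n))"
      using ileI1[of "enat M"] by (simp add: eSuc_enat not_le)
    from bound[OF this] M show False by (simp add: M_def)
  qed
  then obtain s where s: "?S = enat s" "s \<le> M"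
    by (cases ?S) auto
  have "vp p (resultant f g) = enat ?v"
    using assms(4) by (simp add: vp_def)
  moreover have "int s + int (p * pairing p s1 s2) \<le> int (?v + max s1 s2)"
    using s(2) M unfolding M_def by linarith
  ultimately show ?thesis
    using s(1) pairing_eq_sum_min_resolution[of p s1 s2] p_gt_1 by simp
qed

end
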